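(* Let $n\ge1$ and $\ell\ge2$ be integers, and let $0\le i\le n$ and $0\le j\le\ell-1$ be integers such that $\gcd(n+1,\ell,i)=\gcd(\ell,n+1,j)$. Then $$\left|\max{}^+_{A_n^{(1)}}\bigl((\ell-1)\Lambda_0+\Lambda_i\bigr)\right|=\left|\max{}^+_{A_{\ell-1}^{(1)}}\bigl(n\Lambda_0+\Lambda_j\bigr)\right| .$$
   Context: For an affine Kac--Moody algebra $\mathfrak g$ with null root $\delta$ and fundamental weights $\Lambda_0,\Lambda_1,\dots$, and a dominant integral weight $\Lambda$, a weight $\mu$ of the irreducible highest weight module $V(\Lambda)$ is maximal if $\mu+\delta$ is not a weight of $V(\Lambda)$; $\max^+_{\mathfrak g}(\Lambda)$ is the set of maximal weights of $V(\Lambda)$ that are dominant integral. On the left-hand side $\Lambda_i$ are fundamental weights of $A_n^{(1)}$, on the right-hand side $\Lambda_j$ are fundamental weights of $A_{\ell-1}^{(1)}$. *)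

theory Defs
  imports Complex_Main
begin

section \<open>Complex Lie algebras and their modules\<close>

text \<open>The underlying vector space is the whole type, and scalar multiplication is a parameter,
  so every complex Lie algebra is covered by a suitable choice of the type.\<close>

locale lie_algebra = vector_space scaleG
  for scaleG :: "complex \<Rightarrow> 'g::ab_group_add \<Rightarrow> 'g" +
  fixes bracket :: "'g \<Rightarrow> 'g \<Rightarrow> 'g"
  assumes bracket_add_left: "bracket (x + y) z = bracket x z + bracket y z"
    and bracket_add_right: "bracket x (y + z) = bracket x y + bracket x z"
    and bracket_scale_left: "bracket (scaleG a x) y = scaleG a (bracket x y)"
    and bracket_scale_right: "bracket x (scaleG a y) = scaleG a (bracket x y)"
    and bracket_self: "bracket x x = 0"
    and jacobi: "bracket x (bracket y z) + bracket y (bracket z x) + bracket z (bracket x y) = 0"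
begin

definition lie_subalgebra :: "'g set \<Rightarrow> bool" where
  "lie_subalgebra S \<longleftrightarrow> subspace S \<and> (\<forall>x\<in>S. \<forall>y\<in>S. bracket x y \<in> S)"

definition lie_ideal :: "'g set \<Rightarrow> bool" where
  "lie_ideal I \<longleftrightarrow> subspace I \<and> (\<forall>x. \<forall>y\<in>I. bracket x y \<in> I)"

end

locale lie_module = lie_algebra scaleG bracket + V: vector_space scaleV
  for scaleG :: "complex \<Rightarrow> 'g::ab_group_add \<Rightarrow> 'g"
    and bracket :: "'g \<Rightarrow> 'g \<Rightarrow> 'g"
    and scaleV :: "complex \<Rightarrow> 'v::ab_group_add \<Rightarrow> 'v" +
  fixes act :: "'g \<Rightarrow> 'v \<Rightarrow> 'v"
  assumes act_add_left: "act (x + y) v = act x v + act y v"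
    and act_scale_left: "act (scaleG a x) v = scaleV a (act x v)"
    and act_add_right: "act x (v + w) = act x v + act x w"
    and act_scale_right: "act x (scaleV a v) = scaleV a (act x v)"
    and act_bracket: "act (bracket x y) v = act x (act y v) - act y (act x v)"
begin

definition submodule :: "'v set \<Rightarrow> bool" where
  "submodule S \<longleftrightarrow> V.subspace S \<and> (\<forall>x. \<forall>v\<in>S. act x v \<in> S)"

definition irreducible_module :: bool where
  "irreducible_module \<longleftrightarrow>
     (UNIV :: 'v set) \<noteq> {0} \<and> (\<forall>S. submodule S \<longrightarrow> S = {0} \<or> S = UNIV)"

end

section \<open>Affine Cartan datum of type \<open>A\<^sub>n\<^sup>(\<^sup>1\<^sup>)\<close>\<close>

text \<open>The Dynkin diagram is the cycle on \<open>0, \<dots>, n\<close>. For \<open>n = 1\<close> both neighbour conditions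
  hold at once, which gives the entries \<open>-2\<close>.\<close>

definition cartan_matrix :: "nat \<Rightarrow> nat \<Rightarrow> nat \<Rightarrow> int" where
  "cartan_matrix n i j =
     (if i = j then 2
      else - (of_bool (j = (i + 1) mod (n + 1)) + of_bool (i = (j + 1) mod (n + 1))))"

text \<open>Names for the basis of the Cartan subalgebra consisting of the simple coroots
  \<open>h\<^sub>0, \<dots>, h\<^sub>n\<close> and the scaling element \<open>d\<close>. The Cartan subalgebra has dimension \<open>n + 2\<close>
  because the Cartan matrix has size \<open>n + 1\<close> and corank 1.\<close>

datatype cartan_index = Coroot nat | Scaling

definition cartan_basis :: "nat \<Rightarrow> cartan_index set" where
  "cartan_basis n = insert Scaling (Coroot ` {..n})"

text \<open>A linear functional on the Cartan subalgebra is given by its values on this basis. It is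
  normalised to 0 off the basis, so that distinct functions are distinct functionals.\<close>

type_synonym weight = "cartan_index \<Rightarrow> complex"

definition cartan_dual :: "nat \<Rightarrow> weight set" where
  "cartan_dual n = {\<mu>. \<forall>b. b \<notin> cartan_basis n \<longrightarrow> \<mu> b = 0}"

fun simple_root :: "nat \<Rightarrow> nat \<Rightarrow> weight" where
  "simple_root n i (Coroot k) = (if k \<le> n then of_int (cartan_matrix n k i) else 0)"
| "simple_root n i Scaling = (if i = 0 then 1 else 0)"

fun fundamental_weight :: "nat \<Rightarrow> weight" where
  "fundamental_weight i (Coroot k) = (if k = i then 1 else 0)"
| "fundamental_weight i Scaling = 0"

text \<open>All marks of \<open>A\<^sub>n\<^sup>(\<^sup>1\<^sup>)\<close> equal 1.\<close>

definition null_root :: "nat \<Rightarrow> weight" where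
  "null_root n = (\<lambda>b. \<Sum>i\<le>n. simple_root n i b)"

definition dominant_integral :: "nat \<Rightarrow> weight \<Rightarrow> bool" where
  "dominant_integral n \<mu> \<longleftrightarrow> \<mu> \<in> cartan_dual n \<and> (\<forall>k\<le>n. \<mu> (Coroot k) \<in> \<nat>)"

section \<open>The affine Kac--Moody algebra and its highest weight modules\<close>

text \<open>Kac's definition of the algebra attached to a Cartan matrix: the Chevalley generators and
  the Cartan subalgebra satisfy the Weyl relations and generate, and no nonzero ideal meets the
  Cartan subalgebra trivially. This determines the Lie algebra with its generators up to
  isomorphism.\<close>

locale affine_kac_moody_A = lie_algebra scaleG bracket
  for n :: nat
    and scaleG :: "complex \<Rightarrow> 'g::ab_group_add \<Rightarrow> 'g"
    and bracket :: "'g \<Rightarrow> 'g \<Rightarrow> 'g" +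
  fixes e f :: "nat \<Rightarrow> 'g" and h :: "cartan_index \<Rightarrow> 'g"
  assumes h_inj: "inj_on h (cartan_basis n)"
    and h_independent: "\<not> dependent (h ` cartan_basis n)"
    and h_h: "b \<in> cartan_basis n \<Longrightarrow> b' \<in> cartan_basis n \<Longrightarrow> bracket (h b) (h b') = 0"
    and h_e: "b \<in> cartan_basis n \<Longrightarrow> i \<le> n \<Longrightarrow> bracket (h b) (e i) = scaleG (simple_root n i b) (e i)"
    and h_f: "b \<in> cartan_basis n \<Longrightarrow> i \<le> n \<Longrightarrow> bracket (h b) (f i) = scaleG (- simple_root n i b) (f i)"
    and e_f: "i \<le> n \<Longrightarrow> j \<le> n \<Longrightarrow> bracket (e i) (f j) = (if i = j then h (Coroot i) else 0)"
    and generated: "lie_subalgebra S \<Longrightarrow> e ` {..n} \<union> f ` {..n} \<union> h ` cartan_basis n \<subseteq> S \<Longrightarrow> S = UNIV"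
    and no_ideal: "lie_ideal I \<Longrightarrow> I \<inter> span (h ` cartan_basis n) = {0} \<Longrightarrow> I = {0}"

text \<open>The irreducible highest weight module \<open>V(\<Lambda>)\<close>, which is unique up to isomorphism.\<close>

locale irreducible_highest_weight_module =
  affine_kac_moody_A n scaleG bracket e f h + lie_module scaleG bracket scaleV act
  for n :: nat
    and scaleG :: "complex \<Rightarrow> 'g::ab_group_add \<Rightarrow> 'g"
    and bracket :: "'g \<Rightarrow> 'g \<Rightarrow> 'g"
    and e f :: "nat \<Rightarrow> 'g" and h :: "cartan_index \<Rightarrow> 'g"
    and scaleV :: "complex \<Rightarrow> 'v::ab_group_add \<Rightarrow> 'v"
    and act :: "'g \<Rightarrow> 'v \<Rightarrow> 'v" +
  fixes \<Lambda> :: weight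
  assumes irreducible: "irreducible_module"
    and highest_weight_vector:
      "\<exists>v. v \<noteq> 0 \<and> (\<forall>i\<le>n. act (e i) v = 0) \<and>
           (\<forall>b\<in>cartan_basis n. act (h b) v = scaleV (\<Lambda> b) v) \<and>
           (\<forall>S. submodule S \<longrightarrow> v \<in> S \<longrightarrow> S = UNIV)"

definition module_weights ::
  "nat \<Rightarrow> (cartan_index \<Rightarrow> 'g) \<Rightarrow> (complex \<Rightarrow> 'v \<Rightarrow> 'v) \<Rightarrow> ('g \<Rightarrow> 'v \<Rightarrow> 'v::ab_group_add) \<Rightarrow> weight set"
where
  "module_weights n h scaleV act =
     {\<mu> \<in> cartan_dual n. \<exists>v. v \<noteq> 0 \<and> (\<forall>b\<in>cartan_basis n. act (h b) v = scaleV (\<mu> b) v)}"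

definition maximal_weights ::
  "nat \<Rightarrow> (cartan_index \<Rightarrow> 'g) \<Rightarrow> (complex \<Rightarrow> 'v \<Rightarrow> 'v) \<Rightarrow> ('g \<Rightarrow> 'v \<Rightarrow> 'v::ab_group_add) \<Rightarrow> weight set"
where
  "maximal_weights n h scaleV act =
     {\<mu> \<in> module_weights n h scaleV act.
        (\<lambda>b. \<mu> b + null_root n b) \<notin> module_weights n h scaleV act}"

definition dominant_maximal_weights ::
  "nat \<Rightarrow> (cartan_index \<Rightarrow> 'g) \<Rightarrow> (complex \<Rightarrow> 'v \<Rightarrow> 'v) \<Rightarrow> ('g \<Rightarrow> 'v \<Rightarrow> 'v::ab_group_add) \<Rightarrow> weight set"
where
  "dominant_maximal_weights n h scaleV act =
     {\<mu> \<in> maximal_weights n h scaleV act. dominant_integral n \<mu>}"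

end

theory Submission
  imports Defs "HOL-Number_Theory.Cong" "HOL-Computational_Algebra.Primes"
begin

text \<open>A functional \<open>\<Lambda> - \<Sum>\<^sub>i a\<^sub>i \<alpha>\<^sub>i\<close> that is dominant is a weight of \<open>V(\<Lambda>)\<close> as soon as
  all \<open>a\<^sub>i\<close> are natural numbers, so it is maximal iff some \<open>a\<^sub>i\<close> vanishes. Since the affine Cartan
  matrix has kernel \<open>\<int>\<delta>\<close>, the dominant maximal weights correspond to the tuples
  \<open>(m\<^sub>0, \<dots>, m\<^sub>n)\<close> of natural numbers with \<open>\<Sum> m\<^sub>k = \<ell>\<close> and \<open>\<Sum> k m\<^sub>k \<equiv> i\<close> modulo \<open>n + 1\<close>.

  Let \<open>N(a, b, s)\<close> be the number of \<open>m \<in> \<nat>\<^sup>a\<close> with \<open>\<Sum> m\<^sub>k = b\<close> and \<open>\<Sum> k m\<^sub>k \<equiv> s\<close> modulo \<open>a\<close>.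
  Affine permutations of \<open>\<int>/a\<close> show that it depends on \<open>s\<close> only through \<open>gcd(a, b, s)\<close>. Encoding
  tuples as \<open>b\<close>-subsets of \<open>{0, \<dots>, a + b - 2}\<close> and averaging over the rotations of
  \<open>\<int>/(a + b)\<close>, one finds that \<open>(a + b) N(a, b, s)\<close> is \<open>g = gcd(a, b)\<close> times the number of
  \<open>b\<close>-subsets of \<open>{0, \<dots>, a + b - 1}\<close> with sum \<open>s + b(b - 1)/2\<close> modulo \<open>g\<close>; passing to
  complements gives \<open>N(a, b, s) = N(b, a, -s)\<close>.\<close>

section \<open>The Cartan matrix and weights below \<open>\<Lambda>\<close>\<close>

text \<open>The argument \<open>x\<close> stands for the root lattice element
  \<open>\<Sum>k\<le>n. x k * \<alpha>_k\<close>; the result is its pairing with the coroot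
  \<open>i\<close>.\<close>

definition cartan_apply :: "nat \<Rightarrow> (nat \<Rightarrow> int) \<Rightarrow> nat \<Rightarrow> int" where
  "cartan_apply n x i = (\<Sum>k\<le>n. cartan_matrix n i k * x k)"

text \<open>The matrix is a cyclic second difference. Keeping successor and predecessor as two
  separate terms also covers \<open>n = 1\<close>, where they coincide and their contributions add
  up to the entry -2.\<close>

lemma cartan_apply_eq:
  assumes "n \<ge> 1" "i \<le> n"
  shows "cartan_apply n x i = 2 * x i - x (if i = n then 0 else Suc i) - x (if i = 0 then n else i - 1)"
proof -
  let ?s = "if i = n then 0 else Suc i" and ?p = "if i = 0 then n else i - 1"
  have "cartan_matrix n i k * x k
      = (if k = i then 2 * x k else 0) - (if k = ?s then x k else 0) - (if k = ?p then x k else 0)"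
    if "k \<le> n" for k
  proof -
    have "(j + 1) mod (n + 1) = (if j = n then 0 else Suc j)" if "j \<le> n" for j
      using that by auto
    then show ?thesis
      using assms that by (auto simp: cartan_matrix_def)
  qed
  then have "cartan_apply n x i = (\<Sum>k\<le>n. (if k = i then 2 * x k else 0)
      - (if k = ?s then x k else 0) - (if k = ?p then x k else 0))"
    by (simp add: cartan_apply_def)
  also have "\<dots> = (\<Sum>k\<le>n. if k = i then 2 * x k else 0)
      - (\<Sum>k\<le>n. if k = ?s then x k else 0) - (\<Sum>k\<le>n. if k = ?p then x k else 0)"
    by (simp only: sum_subtractf)
  also have "\<dots> = 2 * x i - x ?s - x ?p"
    using assms(2) by (subst (1 2 3) sum.delta) auto
  finally show ?thesis .
qed

lemma sum_shift_succ:
  fixes F :: "nat \<Rightarrow> 'a::comm_monoid_add"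
  shows "(\<Sum>i\<le>n. F (if i = n then 0 else Suc i)) = (\<Sum>i\<le>n. F i)"
proof (cases n)
  case (Suc m)
  have "(\<Sum>i\<le>Suc m. F (if i = Suc m then 0 else Suc i)) = (\<Sum>i\<le>m. F (Suc i)) + F 0"
    by simp
  also have "\<dots> = (\<Sum>i\<le>Suc m. F i)"
    by (simp only: sum.atMost_Suc_shift add.commute)
  finally show ?thesis using Suc by simp
qed simp

lemma sum_shift_pred:
  fixes F :: "nat \<Rightarrow> 'a::comm_monoid_add"
  shows "(\<Sum>i\<le>n. F (if i = 0 then n else i - 1)) = (\<Sum>i\<le>n. F i)"
proof (cases n)
  case (Suc m)
  have "(\<Sum>i\<le>Suc m. F (if i = 0 then Suc m else i - 1)) = F (Suc m) + (\<Sum>i\<le>m. F i)"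
    by (simp only: sum.atMost_Suc_shift) simp
  then show ?thesis unfolding Suc by (simp only: sum.atMost_Suc add.commute)
qed simp

lemma sum_cartan_apply:
  assumes "n \<ge> 1"
  shows "(\<Sum>i\<le>n. cartan_apply n x i) = 0"
proof -
  have "(\<Sum>i\<le>n. cartan_apply n x i)
      = (\<Sum>i\<le>n. 2 * x i - x (if i = n then 0 else Suc i) - x (if i = 0 then n else i - 1))"
    using cartan_apply_eq[OF assms] by (intro sum.cong) auto
  also have "\<dots> = 0"
    unfolding sum_subtractf sum_shift_succ sum_shift_pred by (simp flip: sum_distrib_left)
  finally show ?thesis .
qed

lemma sum_mult_cartan_apply:
  assumes "n \<ge> 1"
  shows "(\<Sum>i\<le>n. int i * cartan_apply n x i) = int (n + 1) * (x n - x 0)"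
proof -
  let ?s = "\<lambda>i. if i = n then 0 else Suc i" and ?p = "\<lambda>i. if i = 0 then n else i - 1"
  \<comment> \<open>\<open>F\<close> and \<open>G\<close> are made so that at the successor,
    respectively the predecessor, of \<open>i\<close> they carry the factor \<open>i\<close>. After
    reindexing the coefficients cancel except at the two ends 0 and \<open>n\<close> of the
    wrap-around.\<close>
  define F where "F k = (if k = 0 then int n else int k - 1) * x k" for k
  define G where "G k = (if k = n then 0 else int k + 1) * x k" for k
  have "int i * cartan_apply n x i = 2 * (int i * x i) - F (?s i) - G (?p i)" if "i \<le> n" for i
    unfolding cartan_apply_eq[OF assms that] using assms that
    by (auto simp: F_def G_def algebra_simps of_nat_diff)
  then have "(\<Sum>i\<le>n. int i * cartan_apply n x i) = (\<Sum>i\<le>n. 2 * (int i * x i) - F (?s i) - G (?p i))"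
    by (intro sum.cong) auto
  also have "\<dots> = (\<Sum>i\<le>n. 2 * (int i * x i) - F i - G i)"
    by (simp only: sum_subtractf sum_shift_succ sum_shift_pred)
  also have "\<dots> = (\<Sum>i\<le>n. (if i = n then int (n + 1) * x i else 0) - (if i = 0 then int (n + 1) * x i else 0))"
    using assms by (intro sum.cong) (auto simp: F_def G_def algebra_simps)
  also have "\<dots> = int (n + 1) * (x n - x 0)"
    by (simp add: sum_subtractf algebra_simps)
  finally show ?thesis .
qed

text \<open>The values sum to 0, so they cannot all have one sign unless they vanish.\<close>

lemma cartan_apply_nonpos_imp_eq_0:
  assumes "n \<ge> 1" "\<And>k. k \<le> n \<Longrightarrow> cartan_apply n x k \<le> 0" "k \<le> n"
  shows "cartan_apply n x k = 0"
  using sum_nonneg_eq_0_iff[of "{..n}" "\<lambda>k. - cartan_apply n x k"] sum_cartan_apply[OF assms(1), of x]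
    assms(2,3)
  by (auto simp: sum_negf)

text \<open>A maximum principle: at a zero of \<open>y\<close> the second difference, which is 0, is
  minus the sum of two nonnegative neighbours, so the neighbours vanish too. The zero travels up to
  \<open>n\<close>, wraps to 0 and reaches every index.\<close>

lemma cartan_apply_nonpos_imp_vanish:
  assumes n: "n \<ge> 1" and nonneg: "\<And>k. k \<le> n \<Longrightarrow> y k \<ge> 0"
    and nonpos: "\<And>k. k \<le> n \<Longrightarrow> cartan_apply n y k \<le> 0"
    and k0: "k0 \<le> n" "y k0 = 0" and k: "k \<le> n"
  shows "y k = 0"
proof -
  have succ: "y (if i = n then 0 else Suc i) = 0" if "i \<le> n" "y i = 0" for i
  proof -
    have "cartan_apply n y i = 0"
      using cartan_apply_nonpos_imp_eq_0[OF n nonpos \<open>i \<le> n\<close>] .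
    then have "y (if i = n then 0 else Suc i) + y (if i = 0 then n else i - 1) = 0"
      using cartan_apply_eq[OF n \<open>i \<le> n\<close>, of y] that by linarith
    moreover have "y (if i = n then 0 else Suc i) \<ge> 0" "y (if i = 0 then n else i - 1) \<ge> 0"
      using that by (auto intro!: nonneg)
    ultimately show ?thesis by linarith
  qed
  have up: "y j = 0" if "i \<le> j" "j \<le> n" "y i = 0" for i j
    using that
  proof (induction j rule: dec_induct)
    case (step m)
    then show ?case using succ[of m] by simp
  qed
  have "y 0 = 0"
    using succ[of n] up[OF k0(1) _ k0(2)] by simp
  then show ?thesis using up[of 0 k] k by simp
qed

lemma cartan_apply_diff:
  "cartan_apply n (\<lambda>k. x k - y k) i = cartan_apply n x i - cartan_apply n y i"
  by (simp add: cartan_apply_def algebra_simps sum_subtractf)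

lemma cartan_apply_const: "n \<ge> 1 \<Longrightarrow> i \<le> n \<Longrightarrow> cartan_apply n (\<lambda>_. c) i = 0"
  by (simp add: cartan_apply_eq)

text \<open>The gap between \<open>x - y\<close> and its maximum is nonnegative, has a zero and is
  mapped to 0, so the maximum principle kills it. Thus the kernel consists of the multiples of
  \<delta>.\<close>

lemma cartan_apply_eq_imp_diff_const:
  assumes n: "n \<ge> 1" and eq: "\<And>k. k \<le> n \<Longrightarrow> cartan_apply n x k = cartan_apply n y k"
  shows "\<exists>c. \<forall>k\<le>n. x k = y k + c"
proof -
  define M where "M = Max ((\<lambda>k. x k - y k) ` {..n})"
  have "M \<in> (\<lambda>k. x k - y k) ` {..n}"
    unfolding M_def by (intro Max_in) auto
  then obtain k0 where k0: "k0 \<le> n" "M - (x k0 - y k0) = 0" by auto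
  have "M - (x k - y k) = 0" if "k \<le> n" for k
  proof (rule cartan_apply_nonpos_imp_vanish[OF n, where y = "\<lambda>k. M - (x k - y k)"])
    fix i assume i: "i \<le> n"
    show "0 \<le> M - (x i - y i)"
      unfolding M_def using i by (simp add: Max_ge)
    show "cartan_apply n (\<lambda>k. M - (x k - y k)) i \<le> 0"
      using cartan_apply_diff[of n "\<lambda>_. M" "\<lambda>k. x k - y k"] cartan_apply_diff[of n x y]
        cartan_apply_const[OF n i] eq[OF i] by simp
  qed (use k0 that in auto)
  then show ?thesis by (intro exI[of _ M]) (auto simp: algebra_simps)
qed

lemma cartan_apply_surj:
  assumes n: "n \<ge> 1" and c: "(\<Sum>k\<le>n. c k) = 0" and dvd: "int (n + 1) dvd (\<Sum>k\<le>n. int k * c k)"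
  shows "\<exists>x. \<forall>k\<le>n. cartan_apply n x k = c k"
proof -
  obtain d where d: "(\<Sum>k\<le>n. int k * c k) = int (n + 1) * (- d)"
    using dvd by (metis dvdE minus_minus)
  \<comment> \<open>Two summations of the equation from the value 0 at 0. The increment
    \<open>d\<close> over the edge from \<open>n\<close> to 0 is chosen so that the value at
    \<open>Suc n\<close> returns to 0; the divisibility makes \<open>d\<close> an integer.\<close>
  define x where "x k = int k * d - (\<Sum>s<k. (int k - int s) * c s)" for k
  have x_Suc: "x (Suc k) = x k + d - (\<Sum>s<Suc k. c s)" for k
  proof -
    have "(\<Sum>s<Suc k. (int (Suc k) - int s) * c s) = (\<Sum>s<Suc k. (int k - int s) * c s) + (\<Sum>s<Suc k. c s)"
      unfolding sum.distrib[symmetric] by (intro sum.cong) (auto simp: algebra_simps)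
    then show ?thesis by (simp add: x_def algebra_simps)
  qed
  have "x (Suc n) = int (n + 1) * d - (int (n + 1) * (\<Sum>s\<le>n. c s) - (\<Sum>s\<le>n. int s * c s))"
    unfolding x_def lessThan_Suc_atMost sum_distrib_left sum_subtractf[symmetric]
    by (simp add: algebra_simps)
  then have x_end: "x (Suc n) = 0"
    using c d by (simp add: algebra_simps)
  have x_0: "x 0 = 0" by (simp add: x_def)
  have x_succ: "x (if k = n then 0 else Suc k) = x (Suc k)" for k
    using x_end x_0 by simp
  have "cartan_apply n x k = c k" if "k \<le> n" for k
  proof (cases k)
    case 0
    have "x n = - d"
      using x_Suc[of n] x_end c by (simp add: lessThan_Suc_atMost)
    then show ?thesis
      using cartan_apply_eq[OF n that, of x] x_succ[of k] x_Suc[of k] x_0 0 by simp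
  next
    case (Suc m)
    then show ?thesis
      using cartan_apply_eq[OF n that, of x] x_succ[of k] x_Suc[of k] x_Suc[of m] by simp
  qed
  then show ?thesis by blast
qed

section \<open>Functionals obtained from \<Lambda> by subtracting simple roots\<close>

definition weight_below :: "nat \<Rightarrow> weight \<Rightarrow> (nat \<Rightarrow> nat) \<Rightarrow> weight" where
  "weight_below n \<Lambda> a = (\<lambda>b. \<Lambda> b - (\<Sum>i\<le>n. of_nat (a i) * simple_root n i b))"

lemma weight_below_upd:
  assumes "i \<le> n"
  shows "weight_below n \<Lambda> (a(i := Suc (a i))) = (\<lambda>b. weight_below n \<Lambda> a b - simple_root n i b)"
proof
  fix b
  have "(\<Sum>j\<le>n. of_nat ((a(i := Suc (a i))) j) * simple_root n j b)
      = (\<Sum>j\<le>n. of_nat (a j) * simple_root n j b + (if j = i then simple_root n j b else 0))"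
    by (intro sum.cong) (auto simp: algebra_simps)
  also have "\<dots> = (\<Sum>j\<le>n. of_nat (a j) * simple_root n j b) + simple_root n i b"
    using assms by (simp add: sum.distrib)
  finally show "weight_below n \<Lambda> (a(i := Suc (a i))) b = weight_below n \<Lambda> a b - simple_root n i b"
    by (simp add: weight_below_def)
qed

lemma simple_root_in_cartan_dual: "simple_root n i \<in> cartan_dual n"
  unfolding cartan_dual_def
proof safe
  fix b assume "b \<notin> cartan_basis n"
  then show "simple_root n i b = 0"
    by (cases b) (auto simp: cartan_basis_def)
qed

lemma weight_below_in_cartan_dual:
  "\<Lambda> \<in> cartan_dual n \<Longrightarrow> weight_below n \<Lambda> a \<in> cartan_dual n"
  using simple_root_in_cartan_dual[of n] by (auto simp: cartan_dual_def weight_below_def)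

lemma weight_below_coroot:
  assumes "k \<le> n" "\<Lambda> (Coroot k) = of_int c"
  shows "weight_below n \<Lambda> a (Coroot k) = of_int (c - cartan_apply n (\<lambda>i. int (a i)) k)"
  using assms by (simp add: weight_below_def cartan_apply_def mult.commute)

text \<open>The scaling element detects the multiple of \<delta>, which no coroot sees.\<close>

lemma weight_below_scaling: "weight_below n \<Lambda> a Scaling = \<Lambda> Scaling - of_nat (a 0)"
proof -
  have "(\<Sum>i\<le>n. of_nat (a i) * simple_root n i Scaling) = (\<Sum>i\<le>n. if i = 0 then of_nat (a i) else 0)"
    by (intro sum.cong) auto
  then show ?thesis by (simp add: weight_below_def)
qed

lemma weight_below_cong:
  "(\<And>i. i \<le> n \<Longrightarrow> a i = a' i) \<Longrightarrow> weight_below n \<Lambda> a = weight_below n \<Lambda> a'"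
  by (simp add: weight_below_def)

text \<open>All marks are 1, so adding \<delta> lowers each coefficient by one. The form with
  \<open>Suc\<close> avoids truncated subtraction.\<close>

lemma weight_below_Suc_plus_null_root:
  "(\<lambda>b. weight_below n \<Lambda> (\<lambda>i. Suc (a i)) b + null_root n b) = weight_below n \<Lambda> a"
  by (simp add: weight_below_def null_root_def fun_eq_iff algebra_simps sum.distrib)

section \<open>Weights of the highest weight module\<close>

context lie_module
begin

lemma act_zero_right [simp]: "act x 0 = 0"
  using act_add_right[of x 0 0] by simp

lemma act_zero_left [simp]: "act 0 v = 0"
  using act_add_left[of 0 0 v] by simp

lemma act_minus_right: "act x (- v) = - act x v"
  using act_add_right[of x v "- v"] by (simp add: eq_neg_iff_add_eq_0 add.commute)

lemma act_minus_left: "act (- x) v = - act x v"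
  using act_add_left[of x "- x" v] by (simp add: eq_neg_iff_add_eq_0 add.commute)

lemma act_diff_right: "act x (v - w) = act x v - act x w"
  using act_add_right[of x "v - w" w] by simp

lemma act_commute: "act x (act y v) = act (bracket x y) v + act y (act x v)"
  by (simp add: act_bracket)

lemma act_in_span:
  assumes "\<And>w. w \<in> B \<Longrightarrow> act x w \<in> V.span C" "v \<in> V.span B"
  shows "act x v \<in> V.span C"
  using assms(2)
proof (rule V.span_induct)
  show "V.subspace {v. act x v \<in> V.span C}"
    by (rule V.subspaceI)
      (auto simp: act_add_right act_scale_right V.span_zero V.span_add V.span_scale)
qed (use assms(1) in auto)

text \<open>Combined with \<open>generated\<close>, this reduces the invariance of a subspace to a
  check on the Chevalley generators and the Cartan basis.\<close>

lemma lie_subalgebra_stabilizer: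
  assumes "V.subspace S"
  shows "lie_subalgebra {x. \<forall>v\<in>S. act x v \<in> S}"
  unfolding lie_subalgebra_def
proof
  show "subspace {x. \<forall>v\<in>S. act x v \<in> S}"
    using assms by (intro subspaceI)
      (auto simp: act_add_left act_scale_left V.subspace_0 V.subspace_add V.subspace_scale)
  show "\<forall>x\<in>{x. \<forall>v\<in>S. act x v \<in> S}. \<forall>y\<in>{x. \<forall>v\<in>S. act x v \<in> S}.
      bracket x y \<in> {x. \<forall>v\<in>S. act x v \<in> S}"
    using assms by (auto simp: act_bracket V.subspace_diff)
qed

end

context irreducible_highest_weight_module
begin

section \<open>Words in the lowering operators span the module\<close>

definition weight_vector :: "weight \<Rightarrow> 'v \<Rightarrow> bool" where
  "weight_vector \<mu> v \<longleftrightarrow> (\<forall>b\<in>cartan_basis n. act (h b) v = scaleV (\<mu> b) v)"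

lemma weight_vector_f:
  assumes "weight_vector \<mu> v" "i \<le> n"
  shows "weight_vector (\<lambda>b. \<mu> b - simple_root n i b) (act (f i) v)"
  using assms
  by (auto simp: weight_vector_def act_commute[of "h _" "f _"] h_f act_scale_left act_scale_right act_minus_left
      V.scale_left_diff_distrib)

lemma weight_vector_e:
  assumes "weight_vector \<mu> v" "i \<le> n"
  shows "weight_vector (\<lambda>b. \<mu> b + simple_root n i b) (act (e i) v)"
  using assms
  by (auto simp: weight_vector_def act_commute[of "h _" "e _"] h_e act_scale_left act_scale_right
      V.scale_left_distrib add.commute)

definition hwv :: 'v where
  "hwv = (SOME v. v \<noteq> 0 \<and> (\<forall>i\<le>n. act (e i) v = 0) \<and>
           (\<forall>b\<in>cartan_basis n. act (h b) v = scaleV (\<Lambda> b) v) \<and>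
           (\<forall>S. submodule S \<longrightarrow> v \<in> S \<longrightarrow> S = UNIV))"

lemma hwv_props:
  shows hwv_nonzero: "hwv \<noteq> 0"
    and e_hwv: "i \<le> n \<Longrightarrow> act (e i) hwv = 0"
    and weight_vector_hwv: "weight_vector \<Lambda> hwv"
    and hwv_generates: "submodule S \<Longrightarrow> hwv \<in> S \<Longrightarrow> S = UNIV"
  using someI_ex[OF highest_weight_vector, folded hwv_def] by (auto simp: weight_vector_def)

primrec f_word :: "nat list \<Rightarrow> 'v" where
  "f_word [] = hwv"
| "f_word (i # w) = act (f i) (f_word w)"

text \<open>Words are graded by length because each \<open>e i\<close> shortens them by one letter,
  which later yields local nilpotency.\<close>

definition f_words :: "nat \<Rightarrow> 'v set" where
  "f_words k = f_word ` {w. set w \<subseteq> {..n} \<and> length w = k}"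

lemma weight_vector_f_word:
  "set w \<subseteq> {..n} \<Longrightarrow> weight_vector (weight_below n \<Lambda> (count_list w)) (f_word w)"
proof (induction w)
  case Nil
  then show ?case using weight_vector_hwv by (simp add: weight_below_def)
next
  case (Cons i w)
  have i: "i \<le> n" "set w \<subseteq> {..n}" using Cons.prems by auto
  have count: "count_list (i # w) = (count_list w)(i := Suc (count_list w i))"
    by auto
  show ?case
    unfolding count weight_below_upd[OF i(1)] f_word.simps(2)
    by (rule weight_vector_f[OF Cons.IH[OF i(2)] i(1)])
qed

lemma f_span_f_words:
  assumes "i \<le> n" "v \<in> V.span (f_words k)"
  shows "act (f i) v \<in> V.span (f_words (Suc k))"
proof (rule act_in_span[OF _ assms(2)])
  fix u assume "u \<in> f_words k"
  then obtain w where "u = f_word w" "set w \<subseteq> {..n}" "length w = k"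
    by (auto simp: f_words_def)
  then have "act (f i) u = f_word (i # w)" "set (i # w) \<subseteq> {..n}" "length (i # w) = Suc k"
    using assms(1) by auto
  then show "act (f i) u \<in> V.span (f_words (Suc k))"
    unfolding f_words_def by (intro V.span_base) blast
qed

text \<open>Move \<open>e i\<close> past the first letter. The commutator is 0 or a coroot, which
  acts on the remaining word by a scalar; the other term is covered by induction, down to
  \<open>hwv\<close>, which \<open>e i\<close> kills.\<close>

lemma e_f_word_Cons:
  assumes "i \<le> n" "set (j # w) \<subseteq> {..n}"
  shows "act (e i) (f_word (j # w)) \<in> V.span (f_words (length w))"
  using assms(2)
proof (induction w arbitrary: j)
  case Nil
  have "f_word [] \<in> V.span (f_words 0)"
    by (intro V.span_base) (auto simp: f_words_def)
  moreover have "act (h (Coroot i)) hwv = scaleV (\<Lambda> (Coroot i)) hwv"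
    using weight_vector_hwv assms(1) by (auto simp: weight_vector_def cartan_basis_def)
  ultimately show ?case
    using assms(1) Nil by (auto simp: act_commute[of "e i"] e_f e_hwv intro: V.span_scale V.span_zero)
next
  case (Cons k w)
  have kw: "set (k # w) \<subseteq> {..n}" "j \<le> n" using Cons.prems by auto
  have "act (f j) (act (e i) (f_word (k # w))) \<in> V.span (f_words (Suc (length w)))"
    by (rule f_span_f_words[OF kw(2) Cons.IH[OF kw(1)]])
  moreover have "act (bracket (e i) (f j)) (f_word (k # w)) \<in> V.span (f_words (Suc (length w)))"
  proof (cases "i = j")
    case True
    have "Coroot i \<in> cartan_basis n" using assms(1) by (simp add: cartan_basis_def)
    then have "act (h (Coroot i)) (f_word (k # w))
        = scaleV (weight_below n \<Lambda> (count_list (k # w)) (Coroot i)) (f_word (k # w))"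
      using weight_vector_f_word[OF kw(1)] unfolding weight_vector_def by blast
    moreover have "f_word (k # w) \<in> f_words (Suc (length w))"
      unfolding f_words_def using kw(1) by (intro imageI) simp
    ultimately show ?thesis
      using True kw(2) e_f[of j j] V.span_scale[OF V.span_base] by simp
  qed (use e_f[OF assms(1) kw(2)] V.span_zero in simp)
  ultimately have "act (bracket (e i) (f j)) (f_word (k # w)) + act (f j) (act (e i) (f_word (k # w)))
      \<in> V.span (f_words (Suc (length w)))"
    using V.span_add by blast
  then show ?case
    unfolding f_word.simps(2)[of j] act_commute[of "e i" "f j"] by simp
qed

lemma e_span_f_words_0:
  assumes "i \<le> n" "v \<in> V.span (f_words 0)"
  shows "act (e i) v = 0"
proof -
  have "act (e i) v \<in> V.span {}"
    by (rule act_in_span[OF _ assms(2)]) (auto simp: f_words_def e_hwv assms(1))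
  then show ?thesis by simp
qed

lemma e_span_f_words_Suc:
  assumes "i \<le> n" "v \<in> V.span (f_words (Suc k))"
  shows "act (e i) v \<in> V.span (f_words k)"
proof (rule act_in_span[OF _ assms(2)])
  fix u assume "u \<in> f_words (Suc k)"
  then obtain j w where "u = f_word (j # w)" "set (j # w) \<subseteq> {..n}" "length w = k"
    by (auto simp: f_words_def length_Suc_conv)
  then show "act (e i) u \<in> V.span (f_words k)"
    using e_f_word_Cons[OF assms(1)] by blast
qed

text \<open>The span is stable under all generators, hence under the whole algebra, so it is a
  submodule containing the generating vector \<open>hwv\<close>.\<close>

lemma span_f_words_UNIV: "V.span (\<Union>k. f_words k) = UNIV"
proof -
  let ?W = "\<Union>k. f_words k"
  let ?T = "{x. \<forall>v\<in>V.span ?W. act x v \<in> V.span ?W}"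
  have sub: "V.span (f_words k) \<subseteq> V.span ?W" for k
    by (intro V.span_mono) auto
  have in_T: "x \<in> ?T" if "\<And>k u. u \<in> f_words k \<Longrightarrow> act x u \<in> V.span ?W" for x
    using act_in_span[of ?W x ?W] that by blast
  have "e i \<in> ?T" if "i \<le> n" for i
  proof (rule in_T)
    fix k u assume "u \<in> f_words k"
    then show "act (e i) u \<in> V.span ?W"
      using e_span_f_words_0[OF that, of u] e_span_f_words_Suc[OF that, of u] sub V.span_zero
        V.span_base[of u] by (cases k) (metis, blast)
  qed
  moreover have "f i \<in> ?T" if "i \<le> n" for i
    using f_span_f_words[OF that] sub V.span_base by (intro in_T) blast
  moreover have "h b \<in> ?T" if "b \<in> cartan_basis n" for b
  proof (rule in_T)
    fix k u assume u: "u \<in> f_words k"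
    then obtain w where w: "u = f_word w" "set w \<subseteq> {..n}"
      by (auto simp: f_words_def)
    have "act (h b) u = scaleV (weight_below n \<Lambda> (count_list w) b) u"
      using weight_vector_f_word[OF w(2)] that w(1) by (simp add: weight_vector_def)
    moreover have "u \<in> V.span ?W" using u by (intro V.span_base) blast
    ultimately show "act (h b) u \<in> V.span ?W" by (simp add: V.span_scale)
  qed
  ultimately have "e ` {..n} \<union> f ` {..n} \<union> h ` cartan_basis n \<subseteq> ?T"
    by blast
  then have "?T = UNIV"
    using generated lie_subalgebra_stabilizer[OF V.subspace_span] by blast
  then have "submodule (V.span ?W)"
    unfolding submodule_def using V.subspace_span by blast
  moreover have "hwv \<in> ?W"
    unfolding f_words_def by (auto intro!: image_eqI[of _ _ "[]"])
  ultimately show ?thesis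
    using hwv_generates V.span_base by blast
qed

lemma in_subspace_if_f_words:
  assumes "V.subspace S" "\<And>k. f_words k \<subseteq> S"
  shows "v \<in> S"
proof -
  have "V.span (\<Union>k. f_words k) \<subseteq> S"
    using assms by (intro V.span_minimal) auto
  then show ?thesis using span_f_words_UNIV by auto
qed

section \<open>Local nilpotency and sl2 strings\<close>

lemma e_pow_linear:
  shows e_pow_zero: "(act (e i) ^^ k) 0 = 0"
    and e_pow_add: "(act (e i) ^^ k) (u + v) = (act (e i) ^^ k) u + (act (e i) ^^ k) v"
    and e_pow_scale: "(act (e i) ^^ k) (scaleV c v) = scaleV c ((act (e i) ^^ k) v)"
  by (induction k) (simp_all add: act_add_right act_scale_right)

text \<open>A word of length \<open>k\<close> dies after \<open>Suc k\<close> applications, and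
  vectors killed by some power form a subspace because exponents can be added.\<close>

lemma e_locally_nilpotent:
  assumes "i \<le> n"
  shows "\<exists>k. (act (e i) ^^ k) v = 0"
proof -
  let ?N = "{v. \<exists>k. (act (e i) ^^ k) v = 0}"
  have "v \<in> ?N"
  proof (rule in_subspace_if_f_words)
    show "V.subspace ?N"
    proof (rule V.subspaceI)
      fix u v assume "u \<in> ?N" "v \<in> ?N"
      then obtain k k' where k: "(act (e i) ^^ k) u = 0" "(act (e i) ^^ k') v = 0" by auto
      have "(act (e i) ^^ (k' + k)) u = 0" "(act (e i) ^^ (k + k')) v = 0"
        unfolding funpow_add using k by (simp_all add: e_pow_zero)
      then have "(act (e i) ^^ (k + k')) (u + v) = 0"
        by (simp add: e_pow_add add.commute)
      then show "u + v \<in> ?N" by blast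
    qed (auto simp: e_pow_zero e_pow_scale)
    fix k
    have "v \<in> V.span (f_words k) \<Longrightarrow> (act (e i) ^^ Suc k) v = 0" for v
    proof (induction k arbitrary: v)
      case 0
      then show ?case using e_span_f_words_0[OF assms] by simp
    next
      case (Suc k)
      then show ?case
        using Suc.IH[OF e_span_f_words_Suc[OF assms Suc.prems]] by (simp only: funpow_Suc_right o_apply)
    qed
    then show "f_words k \<subseteq> ?N"
      using V.span_base by blast
  qed
  then show ?thesis by blast
qed

text \<open>If \<open>f\<^sub>i v = 0\<close> then \<open>v\<close> is a lowest weight vector for the \<open>sl\<^sub>2\<close> of index \<open>i\<close>, and the powers of
  \<open>e\<^sub>i\<close> never kill a lowest weight vector of positive weight.\<close>

lemma f_weight_vector_nonzero:
  assumes v: "weight_vector \<mu> v" "v \<noteq> 0" and i: "i \<le> n"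
    and \<mu>: "\<mu> (Coroot i) = of_int z" "z > 0"
  shows "act (f i) v \<noteq> 0"
proof
  assume fv: "act (f i) v = 0"
  let ?e = "\<lambda>k. (act (e i) ^^ k) v"
  have wt: "weight_vector (\<lambda>b. \<mu> b + of_nat k * simple_root n i b) (?e k)" for k
  proof (induction k)
    case (Suc k)
    show ?case using weight_vector_e[OF Suc i] by (simp add: algebra_simps)
  qed (simp add: v)
  have "Coroot i \<in> cartan_basis n" using i by (simp add: cartan_basis_def)
  moreover have "simple_root n i (Coroot i) = 2" using i by (simp add: cartan_matrix_def)
  ultimately have h: "act (h (Coroot i)) (?e k) = scaleV (of_int (z + 2 * int k)) (?e k)" for k
    using wt[of k] \<mu>(1) unfolding weight_vector_def by (force simp: mult.commute)
  have ef: "act (f i) (act (e i) u) = act (e i) (act (f i) u) - act (h (Coroot i)) u" for u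
    using act_bracket[of "e i" "f i" u] e_f[OF i i] by simp
  \<comment> \<open>The coefficient collects the weights z, z + 2, ..., z + 2k met along the string;
    their sum is (k + 1)(z + k), which is positive since z > 0.\<close>
  have f_e: "act (f i) (?e (Suc k)) = scaleV (- of_int ((int k + 1) * (z + int k))) (?e k)" for k
  proof (induction k)
    case 0
    then show ?case using ef[of v] h[of 0] fv by simp
  next
    case (Suc k)
    have "act (f i) (?e (Suc (Suc k))) = act (e i) (act (f i) (?e (Suc k))) - act (h (Coroot i)) (?e (Suc k))"
      using ef[of "?e (Suc k)"] by simp
    also have "act (e i) (act (f i) (?e (Suc k))) = scaleV (- of_int ((int k + 1) * (z + int k))) (?e (Suc k))"
      unfolding Suc by (simp add: act_scale_right act_minus_right)
    also have "\<dots> - act (h (Coroot i)) (?e (Suc k))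
        = scaleV (- of_int ((int k + 1) * (z + int k)) - of_int (z + 2 * int (Suc k))) (?e (Suc k))"
      unfolding h by (simp only: V.scale_left_diff_distrib)
    also have "- of_int ((int k + 1) * (z + int k)) - of_int (z + 2 * int (Suc k))
        = (- of_int ((int (Suc k) + 1) * (z + int (Suc k))) :: complex)"
      by (simp add: algebra_simps)
    finally show ?case .
  qed
  have "?e k \<noteq> 0" for k
  proof (induction k)
    case (Suc k)
    show ?case
    proof
      assume "?e (Suc k) = 0"
      then have "scaleV (- of_int ((int k + 1) * (z + int k))) (?e k) = 0"
        using f_e[of k] by simp
      then have "(int k + 1) * (z + int k) = 0"
        using Suc by (simp only: V.scale_eq_0_iff neg_equal_0_iff_equal of_int_eq_0_iff simp_thms)
      then show False using \<mu>(2) by simp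
    qed
  qed (use v in simp)
  then show False using e_locally_nilpotent[OF i, of v] by blast
qed

text \<open>Products of operators \<open>h\<^sub>b - c\<close>; they serve to show that weight vectors of different weights
  are linearly independent.\<close>

primrec cartan_ops :: "(cartan_index \<times> complex) list \<Rightarrow> 'v \<Rightarrow> 'v" where
  "cartan_ops [] v = v"
| "cartan_ops (p # L) v = act (h (fst p)) (cartan_ops L v) - scaleV (snd p) (cartan_ops L v)"

lemma cartan_ops_linear:
  shows cartan_ops_zero: "cartan_ops L 0 = 0"
    and cartan_ops_add: "cartan_ops L (u + v) = cartan_ops L u + cartan_ops L v"
    and cartan_ops_scale: "cartan_ops L (scaleV c v) = scaleV c (cartan_ops L v)"
  by (induction L) (simp_all add: act_add_right act_scale_right V.scale_right_distrib
      V.scale_right_diff_distrib V.scale_left_commute)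

lemma cartan_ops_diff: "cartan_ops L (u - v) = cartan_ops L u - cartan_ops L v"
  using cartan_ops_add[of L "u - v" v] by simp

lemma cartan_ops_append: "cartan_ops (L @ M) v = cartan_ops L (cartan_ops M v)"
  by (induction L) simp_all

lemma cartan_ops_act_h:
  assumes "fst ` set L \<subseteq> cartan_basis n" "b \<in> cartan_basis n"
  shows "cartan_ops L (act (h b) v) = act (h b) (cartan_ops L v)"
  using assms(1)
proof (induction L)
  case (Cons p L)
  have "act (h (fst p)) (act (h b) u) = act (h b) (act (h (fst p)) u)" for u
    using act_commute[of "h (fst p)" "h b" u] h_h[of "fst p" b] Cons.prems assms(2) by simp
  then show ?case using Cons by (simp add: act_diff_right act_scale_right)
qed simp

lemma cartan_ops_commute:
  assumes "fst ` set L \<subseteq> cartan_basis n" "fst ` set M \<subseteq> cartan_basis n"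
  shows "cartan_ops L (cartan_ops M v) = cartan_ops M (cartan_ops L v)"
  using assms(2)
  by (induction M) (simp_all add: cartan_ops_diff cartan_ops_scale cartan_ops_act_h[OF assms(1)])

lemma cartan_ops_weight_vector:
  assumes "weight_vector \<mu> v" "fst ` set L \<subseteq> cartan_basis n"
  shows "cartan_ops L v = scaleV (\<Prod>p\<leftarrow>L. \<mu> (fst p) - snd p) v"
  using assms(2)
  by (induction L) (use assms(1) in \<open>auto simp: weight_vector_def act_scale_right
      V.scale_left_diff_distrib left_diff_distrib mult.commute\<close>)

text \<open>Otherwise \<mu> differs from the weight of each word at some basis element, so a factor
  \<open>h b - c\<close> with c different from \<open>\<mu> b\<close> kills that word. As such
  factors commute, a product of them kills \<open>v\<close>, although it multiplies \<open>v\<close>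
  by a nonzero scalar.\<close>

lemma weight_eq_weight_below:
  assumes v: "weight_vector \<mu> v" "v \<noteq> 0"
  shows "\<exists>a. \<forall>b\<in>cartan_basis n. \<mu> b = weight_below n \<Lambda> a b"
proof (rule ccontr)
  assume none: "\<not> ?thesis"
  \<comment> \<open>The second condition makes the scalar on a vector of weight \<mu>
    nonzero.\<close>
  define good where "good L \<longleftrightarrow> fst ` set L \<subseteq> cartan_basis n \<and> (\<forall>p\<in>set L. \<mu> (fst p) \<noteq> snd p)" for L
  let ?S = "{u. \<exists>L. good L \<and> cartan_ops L u = 0}"
  have "v \<in> ?S"
  proof (rule in_subspace_if_f_words)
    show "V.subspace ?S"
    proof (rule V.subspaceI)
      show "0 \<in> ?S" by (auto simp: good_def intro!: exI[of _ "[]"])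
      show "scaleV c u \<in> ?S" if "u \<in> ?S" for c u
        using that by (auto simp: cartan_ops_scale)
      fix u u' assume "u \<in> ?S" "u' \<in> ?S"
      then obtain L L' where L: "good L" "cartan_ops L u = 0" "good L'" "cartan_ops L' u' = 0" by auto
      have "cartan_ops (L' @ L) (u + u') = 0"
        using L cartan_ops_commute[of L' L u'] cartan_ops_zero
        by (simp add: cartan_ops_append cartan_ops_add good_def)
      moreover have "good (L' @ L)" using L by (auto simp: good_def)
      ultimately show "u + u' \<in> ?S" by blast
    qed
    fix k
    show "f_words k \<subseteq> ?S"
    proof
      fix u assume "u \<in> f_words k"
      then obtain w where w: "u = f_word w" "set w \<subseteq> {..n}" by (auto simp: f_words_def)
      let ?\<nu> = "weight_below n \<Lambda> (count_list w)"
      obtain b where b: "b \<in> cartan_basis n" "\<mu> b \<noteq> ?\<nu> b" using none by blast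
      have "cartan_ops [(b, ?\<nu> b)] u = 0"
        using weight_vector_f_word[OF w(2)] b(1) w(1) by (simp add: weight_vector_def)
      moreover have "good [(b, ?\<nu> b)]" using b by (simp add: good_def)
      ultimately show "u \<in> ?S" by blast
    qed
  qed
  then obtain L where L: "good L" "cartan_ops L v = 0" by blast
  then have "(\<Prod>p\<leftarrow>L. \<mu> (fst p) - snd p) = 0"
    using cartan_ops_weight_vector[OF v(1), of L] v(2) by (simp add: good_def)
  then show False using L(1) by (auto simp: good_def prod_list_zero_iff)
qed

section \<open>The set of weights of the module\<close>

abbreviation wts :: "weight set" where
  "wts \<equiv> module_weights n h scaleV act"

lemma wts_iff: "\<mu> \<in> wts \<longleftrightarrow> \<mu> \<in> cartan_dual n \<and> (\<exists>v. v \<noteq> 0 \<and> weight_vector \<mu> v)"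
  by (auto simp: module_weights_def weight_vector_def)

lemma wts_weight_below:
  assumes "\<Lambda> \<in> cartan_dual n" "\<mu> \<in> wts"
  shows "\<exists>a. \<mu> = weight_below n \<Lambda> a"
proof -
  obtain v where "weight_vector \<mu> v" "v \<noteq> 0"
    using assms(2) by (auto simp: wts_iff)
  then obtain a where a: "\<forall>b\<in>cartan_basis n. \<mu> b = weight_below n \<Lambda> a b"
    using weight_eq_weight_below by blast
  moreover have "\<mu> \<in> cartan_dual n" "weight_below n \<Lambda> a \<in> cartan_dual n"
    using assms weight_below_in_cartan_dual by (auto simp: wts_iff)
  ultimately have "\<mu> b = weight_below n \<Lambda> a b" for b
    by (cases "b \<in> cartan_basis n") (auto simp: cartan_dual_def)
  then show ?thesis by blast
qed

lemma weight_below_zero_in_wts: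
  assumes "\<Lambda> \<in> cartan_dual n"
  shows "weight_below n \<Lambda> (\<lambda>_. 0) \<in> wts"
  using assms hwv_nonzero weight_vector_hwv by (auto simp: wts_iff weight_below_def)

text \<open>One step down along a simple root: \<open>f i\<close> does not kill a vector whose
  pairing with coroot \<open>i\<close> is positive.\<close>

lemma weight_below_upd_in_wts:
  assumes "\<Lambda> \<in> cartan_dual n" "weight_below n \<Lambda> a \<in> wts" "i \<le> n"
    "weight_below n \<Lambda> a (Coroot i) = of_int z" "z > 0"
  shows "weight_below n \<Lambda> (a(i := Suc (a i))) \<in> wts"
proof -
  obtain v where v: "weight_vector (weight_below n \<Lambda> a) v" "v \<noteq> 0"
    using assms(2) by (auto simp: wts_iff)
  have "weight_vector (weight_below n \<Lambda> (a(i := Suc (a i)))) (act (f i) v)"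
    unfolding weight_below_upd[OF assms(3)] by (rule weight_vector_f[OF v(1) assms(3)])
  then show ?thesis
    unfolding wts_iff using weight_below_in_cartan_dual[OF assms(1)]
      f_weight_vector_nonzero[OF v assms(3-5)] by blast
qed

text \<open>Among the weights between the dominant \<open>\<Lambda> - \<Sum>\<^sub>i a\<^sub>i \<alpha>\<^sub>i\<close> and \<open>\<Lambda>\<close> take a lowest one,
  \<open>\<Lambda> - \<Sum>\<^sub>i m\<^sub>i \<alpha>\<^sub>i\<close>. It pairs nonpositively with the coroots of all \<open>i\<close> with \<open>m\<^sub>i < a\<^sub>i\<close>, so the Cartan
  matrix maps \<open>a - m\<close> to a nonpositive vector. Hence \<open>m = a\<close>, or \<open>m\<^sub>i < a\<^sub>i\<close> for all \<open>i\<close>, and the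
  latter contradicts the positivity of the level.\<close>

lemma dominant_weight_below_in_wts:
  assumes n: "n \<ge> 1" and \<Lambda>: "\<Lambda> \<in> cartan_dual n"
    and c: "\<And>k. k \<le> n \<Longrightarrow> \<Lambda> (Coroot k) = of_int (c k)" and level: "(\<Sum>k\<le>n. c k) > 0"
    and dom: "\<And>k. k \<le> n \<Longrightarrow> c k \<ge> cartan_apply n (\<lambda>i. int (a i)) k"
  shows "weight_below n \<Lambda> a \<in> wts"
proof -
  let ?P = "\<lambda>m. (\<forall>k\<le>n. m k \<le> a k) \<and> weight_below n \<Lambda> m \<in> wts"
  have "\<exists>m. ?P m \<and> (\<forall>m'. ?P m' \<longrightarrow> (\<Sum>k\<le>n. m' k) \<le> (\<Sum>k\<le>n. m k))"
  proof (rule ex_has_greatest_nat)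
    show "?P (\<lambda>_. 0)" using weight_below_zero_in_wts[OF \<Lambda>] by simp
    show "\<forall>m. ?P m \<longrightarrow> (\<Sum>k\<le>n. m k) < Suc (\<Sum>k\<le>n. a k)"
      by (auto simp: less_Suc_eq_le intro: sum_mono)
  qed
  then obtain m where m: "\<And>k. k \<le> n \<Longrightarrow> m k \<le> a k" "weight_below n \<Lambda> m \<in> wts"
    and max: "\<And>m'. ?P m' \<Longrightarrow> (\<Sum>k\<le>n. m' k) \<le> (\<Sum>k\<le>n. m k)"
    by blast
  define y where "y k = int (a k) - int (m k)" for k
  define z where "z k = c k - cartan_apply n (\<lambda>i. int (m i)) k" for k
  have y_nonneg: "y k \<ge> 0" if "k \<le> n" for k
    using m(1)[OF that] by (simp add: y_def)
  \<comment> \<open>\<open>z k\<close> is the label of the chosen lowest weight; the bracket is the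
    label of the target weight, nonnegative by \<open>dom\<close>.\<close>
  have y_apply: "cartan_apply n y k = z k - (c k - cartan_apply n (\<lambda>i. int (a i)) k)" for k
    unfolding y_def z_def cartan_apply_diff by simp
  have z_nonpos: "z k \<le> 0" if k: "k \<le> n" "y k > 0" for k
  proof (rule ccontr)
    assume "\<not> z k \<le> 0"
    then have "weight_below n \<Lambda> (m(k := Suc (m k))) \<in> wts"
      using weight_below_coroot[of k n \<Lambda> "c k" m] c[OF k(1)] k(1)
      by (intro weight_below_upd_in_wts[OF \<Lambda> m(2), of k "z k"]) (auto simp: z_def)
    moreover have "\<forall>j\<le>n. (m(k := Suc (m k))) j \<le> a j"
      using m(1) k by (auto simp: y_def)
    ultimately have "(\<Sum>j\<le>n. (m(k := Suc (m k))) j) \<le> (\<Sum>j\<le>n. m j)"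
      using max by blast
    moreover have "(\<Sum>j\<le>n. m j) < (\<Sum>j\<le>n. (m(k := Suc (m k))) j)"
      using k(1) by (intro sum_strict_mono_ex1) auto
    ultimately show False by simp
  qed
  \<comment> \<open>Where \<open>y\<close> vanishes, the nonnegative neighbours give the sign.
    Elsewhere it comes from \<open>z k \<le> 0\<close> and the dominance of the target.\<close>
  have nonpos: "cartan_apply n y k \<le> 0" if k: "k \<le> n" for k
  proof (cases "y k = 0")
    case True
    have "y (if k = n then 0 else Suc k) \<ge> 0" "y (if k = 0 then n else k - 1) \<ge> 0"
      using k by (auto intro!: y_nonneg)
    then show ?thesis using cartan_apply_eq[OF n k, of y] True by linarith
  next
    case False
    then show ?thesis using y_nonneg[OF k] z_nonpos[OF k] y_apply[of k] dom[OF k] by linarith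
  qed
  have "\<exists>k\<le>n. y k = 0"
  proof (rule ccontr)
    assume "\<not> (\<exists>k\<le>n. y k = 0)"
    then have "z k \<le> 0" if "k \<le> n" for k
      using z_nonpos[OF that] y_nonneg[OF that] that by force
    then have "(\<Sum>k\<le>n. z k) \<le> 0"
      by (intro sum_nonpos) auto
    moreover have "(\<Sum>k\<le>n. z k) = (\<Sum>k\<le>n. c k)"
      unfolding z_def sum_subtractf sum_cartan_apply[OF n] by simp
    ultimately show False using level by simp
  qed
  then have "y k = 0" if "k \<le> n" for k
    using cartan_apply_nonpos_imp_vanish[OF n y_nonneg nonpos _ _ that] by blast
  then have "weight_below n \<Lambda> a = weight_below n \<Lambda> m"
    by (intro weight_below_cong) (auto simp: y_def)
  then show ?thesis using m(2) by simp
qed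

end

section \<open>Counting tuples by their moment\<close>

text \<open>Tuples of length \<open>a\<close> are functions made 0 from \<open>a\<close> on, so
  counting functions counts tuples.\<close>

definition compositions :: "nat \<Rightarrow> nat \<Rightarrow> (nat \<Rightarrow> nat) set" where
  "compositions a b = {m. (\<forall>k\<ge>a. m k = 0) \<and> (\<Sum>k<a. m k) = b}"

definition moment :: "nat \<Rightarrow> (nat \<Rightarrow> nat) \<Rightarrow> nat" where
  "moment a m = (\<Sum>k<a. k * m k)"

definition residue_count :: "nat \<Rightarrow> nat \<Rightarrow> int \<Rightarrow> nat" where
  "residue_count a b s = card {m \<in> compositions a b. [int (moment a m) = s] (mod int a)}"

lemma finite_compositions [simp]: "finite (compositions a b)"
proof (rule finite_subset)
  show "compositions a b \<subseteq> {m. \<forall>k. (k \<in> {..<a} \<longrightarrow> m k \<in> {..b}) \<and> (k \<notin> {..<a} \<longrightarrow> m k = 0)}"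
    by (auto simp: compositions_def intro: member_le_sum)
  show "finite {m::nat\<Rightarrow>nat. \<forall>k. (k \<in> {..<a} \<longrightarrow> m k \<in> {..b}) \<and> (k \<notin> {..<a} \<longrightarrow> m k = 0)}"
    by (rule finite_set_of_finite_funs) auto
qed

lemma compositions_sumless_0: "compositions a 0 = {\<lambda>_. 0}"
  by (auto simp: compositions_def fun_eq_iff not_less[symmetric])

lemma compositions_1: "compositions (Suc 0) b = {\<lambda>k. if k = 0 then b else 0}"
  by (auto simp: compositions_def fun_eq_iff)

section \<open>Tuples as subsets\<close>

text \<open>Split by whether the last entry is 0. If not, lowering it by one lowers the moment by
  \<open>a\<close>; the arbitrary predicate \<open>P\<close> absorbs this shift in later
  inductions.\<close>

lemma card_compositions_rec:
  "card {m \<in> compositions (Suc a) (Suc b). P (moment (Suc a) m)} =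
   card {m \<in> compositions a (Suc b). P (moment a m)} +
   card {m \<in> compositions (Suc a) b. P (moment (Suc a) m + a)}" (is "card ?S = card ?U + card ?V")
proof -
  let ?T = "{m \<in> ?S. m a \<noteq> 0}"
  have zero_at: "m \<in> compositions a (Suc b) \<longleftrightarrow> m \<in> compositions (Suc a) (Suc b) \<and> m a = 0" for m
  proof (cases "m a = 0")
    case True
    then have "(\<forall>k\<ge>a. m k = 0) \<longleftrightarrow> (\<forall>k\<ge>Suc a. m k = 0)"
      by (auto simp: le_eq_less_or_eq[of a] Suc_le_eq)
    then show ?thesis using True by (simp add: compositions_def)
  qed (auto simp: compositions_def)
  have "moment (Suc a) m = moment a m" if "m a = 0" for m
    using that by (simp add: moment_def)
  then have S: "?S = ?U \<union> ?T"
    using zero_at by auto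
  have "?U \<inter> ?T = {}"
    by (auto simp: compositions_def)
  moreover have "finite ?U" "finite ?T"
    by auto
  moreover have "card ?T = card ?V"
  proof (rule bij_betw_same_card)
    have upd: "(\<Sum>k<a. (m(a := x)) k) = (\<Sum>k<a. m k)"
      "(\<Sum>k<a. k * (m(a := x)) k) = (\<Sum>k<a. k * m k)" for m :: "nat \<Rightarrow> nat" and x
      by (auto intro!: sum.cong)
    show "bij_betw (\<lambda>m. m(a := m a - 1)) ?T ?V"
    proof (rule bij_betw_byWitness[where f' = "\<lambda>m. m(a := m a + 1)"])
      show "(\<lambda>m. m(a := m a - 1)) ` ?T \<subseteq> ?V"
      proof safe
        fix m assume m: "m \<in> compositions (Suc a) (Suc b)" "P (moment (Suc a) m)" "0 < m a"
        then obtain x where x: "m a = Suc x" by (cases "m a") auto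
        show "m(a := m a - 1) \<in> compositions (Suc a) b"
          using m x upd[of m x] by (auto simp: compositions_def)
        show "P (moment (Suc a) (m(a := m a - 1)) + a)"
          using m x upd[of m x] by (auto simp: moment_def algebra_simps)
      qed
      show "(\<lambda>m. m(a := m a + 1)) ` ?V \<subseteq> ?T"
      proof (rule image_subsetI)
        fix m assume m: "m \<in> ?V"
        have "m(a := m a + 1) \<in> compositions (Suc a) (Suc b)"
          using m upd[of m "m a + 1"] by (auto simp: compositions_def)
        moreover have "moment (Suc a) (m(a := m a + 1)) = moment (Suc a) m + a"
          using upd[of m "m a + 1"] by (simp add: moment_def)
        ultimately show "m(a := m a + 1) \<in> ?T" using m by simp
      qed
    qed (auto simp: fun_eq_iff)
  qed
  ultimately show ?thesis
    using arg_cong[OF S, of card] card_Un_disjoint[of ?U ?T] by linarith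
qed

text \<open>The same Pascal recursion for subsets, split by membership of the largest point
  \<open>N\<close>.\<close>

lemma card_subsets_rec:
  "card {B. B \<subseteq> {..<Suc N} \<and> card B = Suc b \<and> P (\<Sum>B)} =
   card {B. B \<subseteq> {..<N} \<and> card B = Suc b \<and> P (\<Sum>B)} +
   card {B. B \<subseteq> {..<N} \<and> card B = b \<and> P (\<Sum>B + N)}" (is "card ?S = card ?U + card ?V")
proof -
  let ?T = "{B \<in> ?S. N \<in> B}"
  have fin: "finite {B. B \<subseteq> {..<M} \<and> Q B}" for M :: nat and Q
    by (rule finite_subset[of _ "Pow {..<M}"]) auto
  have S: "?S = ?U \<union> ?T"
    by (auto simp: lessThan_Suc)
  have "?U \<inter> ?T = {}"
    by auto
  moreover have "finite ?U" "finite ?T"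
    using fin by auto
  moreover have "card ?T = card ?V"
  proof (rule bij_betw_same_card)
    show "bij_betw (\<lambda>B. B - {N}) ?T ?V"
    proof (rule bij_betw_byWitness[where f' = "insert N"])
      show "(\<lambda>B. B - {N}) ` ?T \<subseteq> ?V"
      proof (rule image_subsetI)
        fix B assume "B \<in> ?T"
        then have B: "B \<subseteq> {..<Suc N}" "card B = Suc b" "P (\<Sum>B)" "N \<in> B" by auto
        have finB: "finite B" using B finite_subset by blast
        have "B - {N} \<subseteq> {..<N}"
          using B by (auto simp: less_Suc_eq)
        moreover have "card (B - {N}) = b" using B by simp
        moreover have "\<Sum>(B - {N}) + N = \<Sum>B" using B finB
          by (simp add: sum.remove[of B N "\<lambda>x. x"])
        ultimately show "B - {N} \<in> ?V" using B by simp
      qed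
      show "insert N ` ?V \<subseteq> ?T"
      proof (rule image_subsetI)
        fix B assume "B \<in> ?V"
        then have B: "B \<subseteq> {..<N}" "card B = b" "P (\<Sum>B + N)" by auto
        have finB: "finite B" using B finite_subset by blast
        have N: "N \<notin> B" using B by auto
        have "insert N B \<subseteq> {..<Suc N}" using B by auto
        moreover have "card (insert N B) = Suc b" using finB N B by simp
        moreover have "\<Sum>(insert N B) = \<Sum>B + N" using finB N by simp
        ultimately show "insert N B \<in> ?T" using B by simp
      qed
      show "\<forall>B\<in>?V. insert N B - {N} = B" by auto
    qed auto
  qed
  ultimately show ?thesis
    using arg_cong[OF S, of card] card_Un_disjoint[of ?U ?T] by linarith
qed

text \<open>Stars and bars: list the multiset with multiplicities \<open>m\<close> in increasing
  order and add 0, 1, ..., b - 1 to its elements. This yields a subset and raises the sum by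
  \<open>\<Sum>{..<b}\<close>. The proof compares the two recursions instead of building the
  bijection.\<close>

lemma card_compositions_eq_card_subsets:
  "card {m \<in> compositions (Suc a) b. P (moment (Suc a) m + \<Sum>{..<b})} =
   card {B. B \<subseteq> {..<a + b} \<and> card B = b \<and> P (\<Sum>B)}"
proof (induction a arbitrary: b P)
  case 0
  have "B \<subseteq> {..<b} \<and> card B = b \<longleftrightarrow> B = {..<b}" for B
    using card_subset_eq[of "{..<b}" B] by auto
  then have "{B. B \<subseteq> {..<b} \<and> card B = b \<and> P (\<Sum>B)} = (if P (\<Sum>{..<b}) then {{..<b}} else {})"
    by (simp only: conj_assoc[symmetric]) auto
  moreover have "{m \<in> {\<lambda>k. if k = 0 then b else 0}. P (moment (Suc 0) m + \<Sum>{..<b})}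
    = (if P (\<Sum>{..<b}) then {\<lambda>k. if k = 0 then b else 0} else {})"
    by (auto simp: moment_def)
  ultimately show ?case
    unfolding compositions_1 by simp
next
  case (Suc a)
  note IHa = Suc.IH
  show ?case
  proof (induction b arbitrary: P)
    case 0
    have "{m \<in> {\<lambda>_. 0}. P (moment (Suc (Suc a)) m + \<Sum>{..<0})} = (if P 0 then {\<lambda>_. 0} else {})"
      by (auto simp: moment_def)
    moreover have "{B. B \<subseteq> {..<Suc a} \<and> card B = 0 \<and> P (\<Sum>B)} = (if P 0 then {{}} else {})"
      by (auto dest: finite_subset)
    ultimately show ?case
      unfolding compositions_sumless_0 by simp
  next
    case (Suc b)
    have 1: "card {m \<in> compositions (Suc a) (Suc b). P (moment (Suc a) m + \<Sum>{..<Suc b})} =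
      card {B. B \<subseteq> {..<Suc (a + b)} \<and> card B = Suc b \<and> P (\<Sum>B)}"
      using IHa[of "Suc b" P] by simp
    \<comment> \<open>The point \<open>Suc (a + b)\<close> added on the right matches, on the left,
      \<open>Suc a\<close> from the last entry plus the \<open>b\<close> by which
      \<open>\<Sum>{..<Suc b}\<close> exceeds \<open>\<Sum>{..<b}\<close>.\<close>
    have 2: "card {m \<in> compositions (Suc (Suc a)) b. P (moment (Suc (Suc a)) m + Suc a + \<Sum>{..<Suc b})} =
      card {B. B \<subseteq> {..<Suc (a + b)} \<and> card B = b \<and> P (\<Sum>B + Suc (a + b))}"
      using Suc.IH[of "\<lambda>x. P (x + Suc (a + b))"] by (simp add: algebra_simps)
    show ?case
      using card_compositions_rec[of "Suc a" b "\<lambda>x. P (x + \<Sum>{..<Suc b})"] 1 2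
        card_subsets_rec[of "Suc (a + b)" b P] by simp
  qed
qed

section \<open>Subsets with prescribed sum: rotation and complement\<close>

definition subsets_with_sum :: "nat \<Rightarrow> nat \<Rightarrow> nat \<Rightarrow> int \<Rightarrow> nat set set" where
  "subsets_with_sum g L b s = {B. B \<subseteq> {..<L} \<and> card B = b \<and> [int (\<Sum>B) = s] (mod int g)}"

lemma finite_subsets_with_sum [simp]: "finite (subsets_with_sum g L b s)"
  by (rule finite_subset[of _ "Pow {..<L}"]) (auto simp: subsets_with_sum_def)

text \<open>Rotating a subset of \<open>\<int>/L\<close> by one adds \<open>b\<close> to its sum modulo \<open>L\<close>, hence preserves the sum
  modulo \<open>g\<close>; therefore every point is missed by equally many of these subsets.\<close>

lemma card_subsets_avoiding_le:
  assumes "g dvd L" "g dvd b" "p < L"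
  shows "card {B \<in> subsets_with_sum g L b s. p \<notin> B}
    \<le> card {B \<in> subsets_with_sum g L b s. (p + 1) mod L \<notin> B}"
proof (rule card_inj_on_le)
  let ?r = "\<lambda>x. (x + 1) mod L"
  have inj: "inj_on ?r {..<L}"
  proof (rule inj_onI)
    fix x y assume "x \<in> {..<L}" "y \<in> {..<L}" "?r x = ?r y"
    then show "x = y"
      using cong_add_rcancel_nat[of x 1 y L] by (auto simp: cong_def)
  qed
  show "inj_on (\<lambda>B. ?r ` B) {B \<in> subsets_with_sum g L b s. p \<notin> B}"
    by (rule inj_onI) (use inj in \<open>auto simp: subsets_with_sum_def inj_on_image_eq_iff\<close>)
  show "(\<lambda>B. ?r ` B) ` {B \<in> subsets_with_sum g L b s. p \<notin> B}
    \<subseteq> {B \<in> subsets_with_sum g L b s. (p + 1) mod L \<notin> B}"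
  proof (rule image_subsetI)
    fix B assume "B \<in> {B \<in> subsets_with_sum g L b s. p \<notin> B}"
    then have B: "B \<in> subsets_with_sum g L b s" "p \<notin> B" by auto
    then have BL: "B \<subseteq> {..<L}" and cB: "card B = b" and sB: "[int (\<Sum>B) = s] (mod int g)"
      by (auto simp: subsets_with_sum_def)
    have injB: "inj_on ?r B" using inj BL inj_on_subset by blast
    have "[(\<Sum>x\<in>B. ?r x) = (\<Sum>x\<in>B. x + 1)] (mod g)"
      using assms(1) by (intro cong_sum) (auto simp: cong_def mod_mod_cancel)
    also have "(\<Sum>x\<in>B. x + 1) = \<Sum>B + b"
      unfolding sum.distrib using cB by simp
    also have "[\<Sum>B + b = \<Sum>B] (mod g)"
      using assms(2) by (auto simp: cong_def)
    finally have "[\<Sum>(?r ` B) = \<Sum>B] (mod g)"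
      using injB by (simp add: sum.reindex)
    then have "[int (\<Sum>(?r ` B)) = s] (mod int g)"
      using sB cong_int_iff cong_trans by blast
    moreover have "?r ` B \<subseteq> {..<L}"
      using assms(3) by auto
    ultimately have "?r ` B \<in> subsets_with_sum g L b s"
      using cB injB by (simp add: subsets_with_sum_def card_image)
    moreover have "?r p \<notin> ?r ` B"
    proof
      assume "?r p \<in> ?r ` B"
      then obtain x where x: "x \<in> B" "?r p = ?r x"
        unfolding image_iff by blast
      then have "p = x"
        using inj_onD[OF inj x(2)] BL assms(3) by blast
      then show False using B x(1) by simp
    qed
    ultimately show "?r ` B \<in> {B \<in> subsets_with_sum g L b s. (p + 1) mod L \<notin> B}"
      by blast
  qed
qed auto

text \<open>Count pairs of a subset and a point it misses. The inequalities between successive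
  points close up round the cycle, so all points give the same number; each subset misses
  \<open>Suc L - b\<close> points.\<close>

lemma card_subsets_avoiding:
  assumes "g dvd Suc L" "g dvd b"
  shows "Suc L * card {B \<in> subsets_with_sum g (Suc L) b s. L \<notin> B}
    = (Suc L - b) * card (subsets_with_sum g (Suc L) b s)"
proof -
  let ?X = "subsets_with_sum g (Suc L) b s"
  define c where "c p = card {B \<in> ?X. p \<notin> B}" for p
  have le_next: "c p \<le> c ((p + 1) mod Suc L)" if "p < Suc L" for p
    using card_subsets_avoiding_le[OF assms that] by (simp add: c_def)
  have up: "p \<le> L \<Longrightarrow> c 0 \<le> c p" for p
  proof (induction p)
    case (Suc p)
    then show ?case using le_next[of p] by simp
  qed simp
  have down: "p \<le> L \<Longrightarrow> c p \<le> c L" for p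
  proof (induction rule: inc_induct)
    case (step m)
    then show ?case using le_next[of m] by simp
  qed simp
  have const: "c p = c L" if "p < Suc L" for p
    using up[of p] down[of p] le_next[of L] that by simp
  have "(\<Sum>p<Suc L. c p) = (\<Sum>B\<in>?X. Suc L - b)"
    unfolding c_def
  proof (rule sum_multicount_gen)
    show "\<forall>B\<in>?X. card {p \<in> {..<Suc L}. p \<notin> B} = Suc L - b"
    proof
      fix B assume "B \<in> ?X"
      then have "B \<subseteq> {..<Suc L}" "card B = b" by (auto simp: subsets_with_sum_def)
      moreover have "{p \<in> {..<Suc L}. p \<notin> B} = {..<Suc L} - B" by auto
      ultimately show "card {p \<in> {..<Suc L}. p \<notin> B} = Suc L - b"
        using card_Diff_subset[of B "{..<Suc L}"] finite_subset[of B "{..<Suc L}"] by simp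
    qed
  qed auto
  moreover have "(\<Sum>p<Suc L. c p) = (\<Sum>p<Suc L. c L)"
    by (intro sum.cong refl const) simp
  ultimately have "(\<Sum>p<Suc L. c L) = (\<Sum>B\<in>?X. Suc L - b)"
    by argo
  then show ?thesis
    by (simp only: sum_constant card_lessThan of_nat_id c_def mult.commute)
qed

lemma card_subsets_with_sum_compl:
  "card (subsets_with_sum g (a + b) b s) = card (subsets_with_sum g (a + b) a (int (\<Sum>{..<a + b}) - s))"
proof (rule bij_betw_same_card)
  \<comment> \<open>Stated for general sizes and sums so that it serves both directions of the
    bijection.\<close>
  have *: "{..<a + b} - B \<in> subsets_with_sum g (a + b) a' (int (\<Sum>{..<a + b}) - s')"
    if "B \<in> subsets_with_sum g (a + b) b' s'" "a' + b' = a + b" for B a' b' s'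
  proof -
    have B: "B \<subseteq> {..<a + b}" "card B = b'" "[int (\<Sum>B) = s'] (mod int g)" "finite B"
      using that finite_subset[of B "{..<a + b}"] by (auto simp: subsets_with_sum_def)
    have "\<Sum>{..<a + b} = \<Sum>({..<a + b} - B) + \<Sum>B"
      using B by (simp add: sum.subset_diff)
    then have "int (\<Sum>({..<a + b} - B)) = int (\<Sum>{..<a + b}) - int (\<Sum>B)"
      by linarith
    then show ?thesis
      using B that(2) by (auto simp: subsets_with_sum_def card_Diff_subset intro!: cong_diff)
  qed
  show "bij_betw (\<lambda>B. {..<a + b} - B) (subsets_with_sum g (a + b) b s)
    (subsets_with_sum g (a + b) a (int (\<Sum>{..<a + b}) - s))"
  proof (rule bij_betw_byWitness[where f' = "\<lambda>B. {..<a + b} - B"])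
    show "(\<lambda>B. {..<a + b} - B) ` subsets_with_sum g (a + b) a (int (\<Sum>{..<a + b}) - s)
      \<subseteq> subsets_with_sum g (a + b) b s"
      using *[of _ a "int (\<Sum>{..<a + b}) - s" b] by auto
    show "(\<lambda>B. {..<a + b} - B) ` subsets_with_sum g (a + b) b s
      \<subseteq> subsets_with_sum g (a + b) a (int (\<Sum>{..<a + b}) - s)"
      using *[of _ b s a] by auto
  qed (auto simp: subsets_with_sum_def)
qed

section \<open>Affine symmetry: dependence on the gcd only\<close>

lemma residue_count_cong:
  assumes "[s = s'] (mod int a)"
  shows "residue_count a b s = residue_count a b s'"
proof -
  have "[x = s] (mod int a) \<longleftrightarrow> [x = s'] (mod int a)" for x
    using assms cong_trans cong_sym by blast
  then show ?thesis by (simp add: residue_count_def)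
qed

text \<open>Reindex a tuple along the permutation k -> u k + t of the residues modulo
  \<open>a\<close>. The old moment is congruent to u times the new one plus t b, and reindexing is
  injective.\<close>

lemma residue_count_affine_le:
  assumes "a > 0" "coprime u (int a)"
  shows "residue_count a b (u * s + t * int b) \<le> residue_count a b s"
  unfolding residue_count_def
proof (rule card_inj_on_le)
  define \<sigma> where "\<sigma> k = nat ((u * int k + t) mod int a)" for k
  have \<sigma>_int: "int (\<sigma> k) = (u * int k + t) mod int a" for k
    using assms(1) by (simp add: \<sigma>_def)
  have \<sigma>_less: "\<sigma> k < a" for k
    using \<sigma>_int[of k] assms(1) by (metis of_nat_0_less_iff of_nat_less_iff pos_mod_bound)
  have inj: "inj_on \<sigma> {..<a}"
  proof (rule inj_onI)
    fix x y assume xy: "x \<in> {..<a}" "y \<in> {..<a}" "\<sigma> x = \<sigma> y"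
    then have "[u * int x + t = u * int y + t] (mod int a)"
      using \<sigma>_int[of x] \<sigma>_int[of y] by (simp add: cong_def)
    then have "[int x = int y] (mod int a)"
      using assms(2) cong_add_rcancel cong_mult_lcancel by blast
    then show "x = y"
      using xy by (simp add: cong_int_iff cong_less_modulus_unique_nat)
  qed
  have bij: "bij_betw \<sigma> {..<a} {..<a}"
    using inj \<sigma>_less by (intro bij_betw_imageI endo_inj_surj) auto
  define r where "r m = (\<lambda>k. if k < a then m (\<sigma> k) else 0)" for m :: "nat \<Rightarrow> nat"
  show "inj_on r {m \<in> compositions a b. [int (moment a m) = u * s + t * int b] (mod int a)}"
  proof (rule inj_onI)
    fix m m' assume m: "m \<in> {m \<in> compositions a b. [int (moment a m) = u * s + t * int b] (mod int a)}"
      "m' \<in> {m \<in> compositions a b. [int (moment a m) = u * s + t * int b] (mod int a)}" "r m = r m'"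
    show "m = m'"
    proof
      fix k show "m k = m' k"
      proof (cases "k < a")
        case True
        then obtain x where "x < a" "k = \<sigma> x"
          using bij by (auto simp: bij_betw_def)
        then show ?thesis using fun_cong[OF m(3), of x] by (simp add: r_def)
      next
        case False then show ?thesis using m by (simp add: compositions_def)
      qed
    qed
  qed
  show "r ` {m \<in> compositions a b. [int (moment a m) = u * s + t * int b] (mod int a)}
    \<subseteq> {m \<in> compositions a b. [int (moment a m) = s] (mod int a)}"
  proof safe
    fix m assume m: "m \<in> compositions a b" "[int (moment a m) = u * s + t * int b] (mod int a)"
    have sum: "(\<Sum>k<a. F (\<sigma> k)) = (\<Sum>k<a. F k)" for F :: "nat \<Rightarrow> int"
      using sum.reindex_bij_betw[OF bij, of F] .
    have b: "(\<Sum>k<a. int (r m k)) = int b"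
      using sum[of "\<lambda>k. int (m k)"] m(1) by (simp add: r_def compositions_def flip: of_nat_sum)
    then show "r m \<in> compositions a b"
      by (auto simp: compositions_def r_def simp flip: of_nat_sum)
    have "int (moment a m) = (\<Sum>k<a. int (\<sigma> k) * int (r m k))"
      using sum[of "\<lambda>k. int k * int (m k)"] by (simp add: r_def moment_def)
    also have "[\<dots> = (\<Sum>k<a. (u * int k + t) * int (r m k))] (mod int a)"
      by (intro cong_sum cong_mult) (auto simp: \<sigma>_int cong_def)
    also have "(\<Sum>k<a. (u * int k + t) * int (r m k)) = u * int (moment a (r m)) + t * int b"
      unfolding b[symmetric] by (simp add: moment_def sum.distrib sum_distrib_left algebra_simps)
    finally have "[u * int (moment a (r m)) + t * int b = u * s + t * int b] (mod int a)"
      using m(2) cong_trans cong_sym by blast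
    then show "[int (moment a (r m)) = s] (mod int a)"
      using assms(2) cong_add_rcancel cong_mult_lcancel by blast
  qed
qed auto

text \<open>The reverse inequality comes from the inverse affine map, built with an inverse
  \<open>v\<close> of \<open>u\<close> modulo \<open>a\<close>.\<close>

lemma residue_count_affine:
  assumes "a > 0" "coprime u (int a)"
  shows "residue_count a b (u * s + t * int b) = residue_count a b s"
proof (rule antisym)
  obtain v where v: "[u * v = 1] (mod int a)"
    using assms(2) cong_solve_coprime_int by blast
  then have cop: "coprime v (int a)"
    using coprime_iff_invertible_int by (metis mult.commute)
  have "v * (u * s + t * int b) + (- v * t) * int b = (u * v) * s"
    by (simp add: algebra_simps)
  also have "[\<dots> = 1 * s] (mod int a)"
    using v by (intro cong_mult) auto
  finally have "residue_count a b s = residue_count a b (v * (u * s + t * int b) + (- v * t) * int b)"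
    by (intro residue_count_cong) (simp add: cong_sym)
  also have "\<dots> \<le> residue_count a b (u * s + t * int b)"
    by (rule residue_count_affine_le[OF assms(1) cop])
  finally show "residue_count a b s \<le> residue_count a b (u * s + t * int b)" .
qed (rule residue_count_affine_le[OF assms])

lemma exists_gcd_add_mult:
  fixes a b s :: int
  assumes "a \<noteq> 0"
  shows "\<exists>t. gcd (s + t * b) a = gcd s (gcd b a)"
proof -
  define e where "e = gcd s (gcd b a)"
  have "e \<noteq> 0" using assms by (simp add: e_def)
  obtain s' where s: "s = e * s'" unfolding e_def by (meson dvdE gcd_dvd1)
  obtain b' where b: "b = e * b'" unfolding e_def by (meson dvdE gcd_dvd1 gcd_dvd2 dvd_trans)
  obtain a' where a: "a = e * a'" unfolding e_def by (meson dvdE gcd_dvd2 dvd_trans)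
  have "a' \<noteq> 0" using a assms by auto
  have "gcd s (gcd b a) = \<bar>e\<bar> * gcd s' (gcd b' a')"
  proof -
    have "gcd b a = \<bar>e * gcd b' a'\<bar>"
      unfolding b a by (simp add: abs_mult flip: gcd_mult_distrib_int)
    then have "gcd s (gcd b a) = gcd (e * s') (e * gcd b' a')"
      unfolding s by (simp only: gcd_abs2_int)
    then show ?thesis by (simp only: gcd_mult_distrib_int)
  qed
  moreover have "\<bar>e\<bar> = e" by (simp add: e_def)
  ultimately have one: "gcd s' (gcd b' a') = 1"
    using \<open>e \<noteq> 0\<close> unfolding e_def[symmetric] by simp
  \<comment> \<open>After division by \<open>e\<close> the three numbers have no common prime. A
    prime of \<open>a'\<close> dividing \<open>s'\<close> then divides neither \<open>t\<close> nor
    \<open>b'\<close>, while any other prime of \<open>a'\<close> divides \<open>t\<close> but not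
    \<open>s'\<close>; so no prime of \<open>a'\<close> divides \<open>s' + t * b'\<close>.\<close>
  define t where "t = \<Prod>{p \<in> prime_factors a'. \<not> p dvd s'}"
  have "coprime (s' + t * b') a'"
  proof (rule ccontr)
    assume "\<not> coprime (s' + t * b') a'"
    then have "\<not> is_unit (gcd (s' + t * b') a')" "gcd (s' + t * b') a' \<noteq> 0"
      using \<open>a' \<noteq> 0\<close> by (simp_all only: is_unit_gcd gcd_eq_0_iff simp_thms)
    then obtain p where "prime p" "p dvd gcd (s' + t * b') a'"
      using prime_divisor_exists by blast
    then have p: "prime p" "p dvd s' + t * b'" "p dvd a'"
      by simp_all
    show False
    proof (cases "p dvd s'")
      case True
      have "\<not> p dvd t"
      proof
        assume "p dvd t"
        then obtain q where "q \<in> {p \<in> prime_factors a'. \<not> p dvd s'}" "p dvd q"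
          unfolding t_def using p(1) prime_dvd_prod_iff[of "{p \<in> prime_factors a'. \<not> p dvd s'}" p "\<lambda>x. x"]
          by auto
        then show False using p(1) True primes_dvd_imp_eq[of p q] by auto
      qed
      moreover have "p dvd t * b'" using True p(2) by (simp add: dvd_add_right_iff)
      ultimately have "p dvd b'" using p(1) prime_dvd_mult_iff by blast
      then have "p dvd gcd s' (gcd b' a')" using True p(3) by simp
      then show False using one p(1) by (metis not_prime_unit)
    next
      case False
      then have "p \<in> {p \<in> prime_factors a'. \<not> p dvd s'}"
        using p \<open>a' \<noteq> 0\<close> by (auto simp: prime_factors_dvd)
      then have "p dvd t" unfolding t_def by (intro dvd_prodI) auto
      then show False using False p(2) by (simp add: dvd_add_left_iff)
    qed
  qed
  then have "gcd (e * (s' + t * b')) (e * a') = \<bar>e\<bar>"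
    by (simp flip: gcd_mult_distrib_int)
  then have "gcd (s + t * b) a = e"
    unfolding s b a by (simp add: algebra_simps e_def)
  then show ?thesis unfolding e_def by blast
qed

text \<open>A translation turns \<open>s\<close> into a residue whose gcd with \<open>a\<close> is
  \<open>e\<close>, say e s'. Since s' matters only modulo a / e, it can be replaced by a unit
  modulo \<open>a\<close>, and multiplication by this unit carries \<open>e\<close> to that
  residue.\<close>

lemma residue_count_eq_gcd:
  assumes "a > 0"
  shows "residue_count a b s = residue_count a b (gcd s (gcd (int b) (int a)))"
proof -
  let ?e = "gcd s (gcd (int b) (int a))"
  obtain t where t: "gcd (s + t * int b) (int a) = ?e"
    using exists_gcd_add_mult[of "int a" s "int b"] assms by (metis of_nat_0_less_iff less_irrefl)
  define e where "e = ?e"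
  have "e \<noteq> 0" using assms by (simp add: e_def)
  obtain s' where s': "s + t * int b = e * s'" unfolding e_def t[symmetric] by (meson dvdE gcd_dvd1)
  obtain a' where a': "int a = e * a'" unfolding e_def t[symmetric] by (meson dvdE gcd_dvd2)
  have "\<bar>e\<bar> * gcd s' a' = e"
    using t[folded e_def] unfolding s' a' gcd_mult_distrib_int .
  moreover have "\<bar>e\<bar> = e" by (simp add: e_def)
  ultimately have "gcd s' a' = 1" using \<open>e \<noteq> 0\<close> by simp
  moreover obtain t' where "gcd (s' + t' * a') (int a) = gcd s' (gcd a' (int a))"
    using exists_gcd_add_mult[of "int a" s' a'] assms by (metis of_nat_0_less_iff less_irrefl)
  ultimately have cop: "coprime (s' + t' * a') (int a)"
    by (simp add: coprime_iff_gcd_eq_1 gcd.assoc[symmetric])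
  have "residue_count a b s = residue_count a b (1 * s + t * int b)"
    by (rule residue_count_affine[symmetric]) (use assms in auto)
  also have "\<dots> = residue_count a b ((s' + t' * a') * e + 0 * int b)"
  proof (rule residue_count_cong)
    have "(s' + t' * a') * e + 0 * int b = 1 * s + t * int b + int a * t'"
      using s' a' by (simp add: algebra_simps)
    then show "[1 * s + t * int b = (s' + t' * a') * e + 0 * int b] (mod int a)"
      by (simp add: cong_def)
  qed
  also have "\<dots> = residue_count a b e"
    by (rule residue_count_affine[OF assms cop])
  finally show ?thesis by (simp add: e_def)
qed

section \<open>Reciprocity between tuple length and sum\<close>

text \<open>A class modulo g splits into a / g classes modulo \<open>a\<close>. Their
  representatives differ by multiples of g, so they share the gcd with \<open>a\<close> and
  \<open>b\<close> and have equal counts.\<close>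

lemma card_compositions_mod_gcd:
  assumes "a > 0"
  shows "card {m \<in> compositions a b. [int (moment a m) = s] (mod int (gcd a b))}
    = a div gcd a b * residue_count a b s"
proof -
  define g where "g = gcd a b"
  define q where "q = a div g"
  have g: "g > 0" "a = g * q" using assms by (auto simp: g_def q_def)
  have q: "q > 0" using g assms by (cases q) auto
  let ?C = "\<lambda>k. {m \<in> compositions a b. [int (moment a m) = s + int g * int k] (mod int a)}"
  have "{m \<in> compositions a b. [int (moment a m) = s] (mod int g)} = (\<Union>k<q. ?C k)"
  proof safe
    fix m assume m: "m \<in> compositions a b" "[int (moment a m) = s] (mod int g)"
    then obtain x where x: "int (moment a m) = s + int g * x"
      by (metis cong_iff_lin cong_sym)
    define k where "k = nat (x mod int q)"
    have k: "k < q" "int k = x mod int q"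
      using q by (auto simp: k_def nat_less_iff)
    have "x = int k + int q * (x div int q)" using k by simp
    then obtain y where y: "x = int k + int q * y" ..
    have "int (moment a m) = s + int g * int k + int a * y"
      unfolding x y arg_cong[OF g(2), of int] by (simp add: algebra_simps)
    then have "m \<in> ?C k" using m(1) by (simp add: cong_def)
    then show "m \<in> (\<Union>k<q. ?C k)" using k by blast
  next
    fix m k assume "[int (moment a m) = s + int g * int k] (mod int a)"
    then have "[int (moment a m) = s + int g * int k] (mod int g)"
      using g(2) cong_dvd_modulus by (metis dvd_triv_left of_nat_mult)
    then show "[int (moment a m) = s] (mod int g)" by (simp add: cong_def)
  qed
  also have "card \<dots> = (\<Sum>k<q. card (?C k))"
  proof (rule card_UN_disjoint)
    show "\<forall>k\<in>{..<q}. \<forall>k'\<in>{..<q}. k \<noteq> k' \<longrightarrow> ?C k \<inter> ?C k' = {}"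
    proof (intro ballI impI, rule ccontr)
      fix k k' assume k: "k \<in> {..<q}" "k' \<in> {..<q}" "k \<noteq> k'" "?C k \<inter> ?C k' \<noteq> {}"
      then obtain x where "[x = s + int g * int k] (mod int a)" "[x = s + int g * int k'] (mod int a)"
        by blast
      then have "[s + int g * int k = s + int g * int k'] (mod int a)"
        using cong_trans cong_sym by blast
      then have "[g * k = g * k'] (mod g * q)"
        unfolding g(2) cong_add_lcancel by (simp flip: of_nat_mult add: cong_int_iff)
      then have "[k = k'] (mod q)"
        using g(1) by (simp add: cong_def)
      then show False using k by (simp add: cong_less_modulus_unique_nat)
    qed
  qed auto
  also have "\<dots> = (\<Sum>k<q. residue_count a b s)"
  proof (rule sum.cong)
    fix k
    have "gcd (s + int g * int k) (gcd (int b) (int a)) = gcd s (gcd (int b) (int a))"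
      unfolding g_def
      by (metis gcd.commute gcd_add_mult gcd_int_int_eq mult.commute add.commute)
    then show "card (?C k) = residue_count a b s"
      using residue_count_eq_gcd[OF assms, of b s] residue_count_eq_gcd[OF assms, of b "s + int g * int k"]
      by (simp add: residue_count_def)
  qed simp
  finally show ?thesis by (simp add: g_def q_def)
qed

text \<open>Tuples modulo g correspond to subsets of \<open>{..<a + b}\<close> that miss the last
  point. By rotation these are the fraction a / (a + b) of all subsets with the given sum; dividing
  by the a / g classes leaves the factor g.\<close>

lemma residue_count_eq_subsets:
  assumes "a > 0"
  shows "(a + b) * residue_count a b s
    = gcd a b * card (subsets_with_sum (gcd a b) (a + b) b (s + int (\<Sum>{..<b})))"
proof -
  define g where "g = gcd a b"
  obtain n where n: "a = Suc n" using assms by (cases a) auto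
  let ?s = "s + int (\<Sum>{..<b})"
  have "card {m \<in> compositions a b. [int (moment a m) = s] (mod int g)} =
     card {m \<in> compositions (Suc n) b. [int (moment (Suc n) m + \<Sum>{..<b}) = ?s] (mod int g)}"
    unfolding n of_nat_add cong_add_rcancel ..
  also have "\<dots> = card {B. B \<subseteq> {..<n + b} \<and> card B = b \<and> [int (\<Sum>B) = ?s] (mod int g)}"
    by (rule card_compositions_eq_card_subsets)
  also have "{B. B \<subseteq> {..<n + b} \<and> card B = b \<and> [int (\<Sum>B) = ?s] (mod int g)}
     = {B \<in> subsets_with_sum g (Suc (n + b)) b ?s. n + b \<notin> B}"
    by (auto simp: subsets_with_sum_def lessThan_Suc)
  finally have 1: "a div g * residue_count a b s = card {B \<in> subsets_with_sum g (Suc (n + b)) b ?s. n + b \<notin> B}"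
    using card_compositions_mod_gcd[OF assms, of b s] by (simp add: g_def)
  have "g dvd Suc (n + b)" using n by (metis add_Suc dvd_add gcd_dvd1 gcd_dvd2 g_def)
  then have "Suc (n + b) * (a div g * residue_count a b s) = a * card (subsets_with_sum g (a + b) b ?s)"
    unfolding 1 using card_subsets_avoiding[of g "n + b" b ?s] n by (simp add: g_def)
  moreover have "a = (a div g) * g" by (simp add: g_def)
  ultimately have "(a div g) * ((a + b) * residue_count a b s) = (a div g) * (g * card (subsets_with_sum g (a + b) b ?s))"
    using n by (metis add_Suc mult.assoc mult.left_commute)
  moreover have "a div g \<noteq> 0"
    using assms by (metis \<open>a = a div g * g\<close> mult_zero_left less_irrefl)
  ultimately show ?thesis by (simp add: g_def)
qed

lemma sum_lessThan_add: "\<Sum>{..<a + b} = \<Sum>{..<a} + \<Sum>{..<b} + a * (b::nat)"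
  by (induction b) auto

text \<open>Apply the subset formula on both sides and pass to complements. The two target sums
  differ by a b, which g divides.\<close>

lemma residue_count_reciprocity:
  assumes "a > 0" "b > 0"
  shows "residue_count a b s = residue_count b a (- s)"
proof -
  let ?g = "gcd a b"
  have "[int (\<Sum>{..<a + b}) - (s + int (\<Sum>{..<b})) = - s + int (\<Sum>{..<a})] (mod int ?g)"
  proof -
    have "int (\<Sum>{..<a + b}) - (s + int (\<Sum>{..<b})) - (- s + int (\<Sum>{..<a})) = int a * int b"
      unfolding sum_lessThan_add by simp
    moreover have "int ?g dvd int a * int b" by (intro dvd_mult2) simp
    ultimately show ?thesis by (simp only: cong_iff_dvd_diff)
  qed
  then have "subsets_with_sum ?g (a + b) a (int (\<Sum>{..<a + b}) - (s + int (\<Sum>{..<b})))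
    = subsets_with_sum ?g (a + b) a (- s + int (\<Sum>{..<a}))"
    unfolding subsets_with_sum_def using cong_trans cong_sym by blast
  then have "(a + b) * residue_count a b s = (a + b) * residue_count b a (- s)"
    using residue_count_eq_subsets[OF assms(1), of b s] residue_count_eq_subsets[OF assms(2), of a "- s"]
      card_subsets_with_sum_compl[of ?g a b "s + int (\<Sum>{..<b})"]
    by (simp add: gcd.commute add.commute)
  then show ?thesis using assms by simp
qed

text \<open>The sign from reciprocity disappears, since the count depends on the residue only
  through a gcd.\<close>

lemma residue_count_eq_if_gcd_eq:
  assumes "a > 0" "b > 0" "gcd (gcd a b) i = gcd (gcd b a) j"
  shows "residue_count a b (int i) = residue_count b a (int j)"
proof -
  have "gcd (- int i) (gcd (int a) (int b)) = gcd (int j) (gcd (int a) (int b))"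
    using assms(3) by (simp add: gcd_int_int_eq gcd.commute)
  then show ?thesis
    using residue_count_reciprocity[OF assms(1,2)] residue_count_eq_gcd[OF assms(2)] by metis
qed

section \<open>Dominant maximal weights as tuples\<close>

lemma cartan_apply_cong:
  "(\<And>i. i \<le> n \<Longrightarrow> x i = y i) \<Longrightarrow> cartan_apply n x k = cartan_apply n y k"
  by (simp add: cartan_apply_def)

text \<open>The coroots determine the coefficients up to a common constant, and the scaling element
  fixes it through \<open>a 0\<close>.\<close>

lemma weight_below_inject:
  assumes n: "n \<ge> 1" and eq: "weight_below n \<Lambda> a = weight_below n \<Lambda> a'"
    and c: "\<And>k. k \<le> n \<Longrightarrow> \<Lambda> (Coroot k) = of_int (c k)" and i: "i \<le> n"
  shows "a i = a' i"
proof -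
  have "cartan_apply n (\<lambda>i. int (a i)) k = cartan_apply n (\<lambda>i. int (a' i)) k" if "k \<le> n" for k
  proof -
    have "(of_int (c k - cartan_apply n (\<lambda>i. int (a i)) k) :: complex)
        = of_int (c k - cartan_apply n (\<lambda>i. int (a' i)) k)"
      using weight_below_coroot[of k n \<Lambda> "c k" a] weight_below_coroot[of k n \<Lambda> "c k" a'] eq c that
      by metis
    then show ?thesis unfolding of_int_eq_iff by simp
  qed
  then obtain t where t: "\<forall>k\<le>n. int (a k) = int (a' k) + t"
    using cartan_apply_eq_imp_diff_const[OF n, of "\<lambda>i. int (a i)" "\<lambda>i. int (a' i)"] by blast
  have "a 0 = a' 0"
    using fun_cong[OF eq, of Scaling] by (simp add: weight_below_scaling)
  then have "t = 0" using spec[OF t, of 0] by simp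
  then show ?thesis using spec[OF t, of i] i by simp
qed

text \<open>The Dynkin labels of a dominant weight as natural numbers, extended by 0 to fit
  \<open>compositions\<close>.\<close>

definition labels :: "nat \<Rightarrow> weight \<Rightarrow> nat \<Rightarrow> nat" where
  "labels n \<mu> k = (if k \<le> n then nat \<lfloor>Re (\<mu> (Coroot k))\<rfloor> else 0)"

lemma of_int_in_Nats_iff: "(of_int z :: complex) \<in> \<nat> \<longleftrightarrow> z \<ge> 0"
proof
  assume "(of_int z :: complex) \<in> \<nat>"
  then obtain m where "(of_int z :: complex) = of_int (int m)"
    by (auto elim: Nats_cases)
  then show "z \<ge> 0" unfolding of_int_eq_iff by simp
next
  assume "z \<ge> 0"
  then show "(of_int z :: complex) \<in> \<nat>"
    by (metis int_nat_eq of_int_of_nat_eq of_nat_in_Nats)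
qed

context irreducible_highest_weight_module
begin

context
  fixes c :: "nat \<Rightarrow> nat"
  assumes n: "n \<ge> 1" and \<Lambda>: "\<Lambda> \<in> cartan_dual n"
    and c: "\<And>k. k \<le> n \<Longrightarrow> \<Lambda> (Coroot k) = of_nat (c k)" and level: "(\<Sum>k\<le>n. c k) > 0"
begin

lemma c_int: "k \<le> n \<Longrightarrow> \<Lambda> (Coroot k) = of_int (int (c k))"
  by (simp add: c)

lemma coroot_weight_below:
  "k \<le> n \<Longrightarrow> weight_below n \<Lambda> a (Coroot k) = of_int (int (c k) - cartan_apply n (\<lambda>i. int (a i)) k)"
  using weight_below_coroot[of k n \<Lambda> "int (c k)"] c_int by blast

lemma dominant_in_wts:
  assumes "\<And>k. k \<le> n \<Longrightarrow> int (c k) \<ge> cartan_apply n (\<lambda>i. int (a i)) k"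
  shows "weight_below n \<Lambda> a \<in> wts"
proof (rule dominant_weight_below_in_wts[OF n \<Lambda> c_int _ assms])
  show "0 < (\<Sum>k\<le>n. int (c k))"
    using level by (simp flip: of_nat_sum)
qed

text \<open>If every coefficient is positive, lowering all by one keeps the labels, so the weight
  plus \<delta> is dominant and again a weight. If \<open>a i = 0\<close>, adding \<delta> would
  require a negative coefficient at \<open>i\<close>.\<close>

lemma maximal_iff:
  assumes dom: "\<And>k. k \<le> n \<Longrightarrow> int (c k) \<ge> cartan_apply n (\<lambda>i. int (a i)) k"
  shows "weight_below n \<Lambda> a \<in> maximal_weights n h scaleV act \<longleftrightarrow> (\<exists>i\<le>n. a i = 0)"
proof
  assume max: "weight_below n \<Lambda> a \<in> maximal_weights n h scaleV act"
  show "\<exists>i\<le>n. a i = 0"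
  proof (rule ccontr)
    assume "\<not> (\<exists>i\<le>n. a i = 0)"
    then have Suc_pred: "Suc (a i - 1) = a i" if "i \<le> n" for i
      using that by (cases "a i") auto
    then have *: "weight_below n \<Lambda> (\<lambda>i. Suc (a i - 1)) = weight_below n \<Lambda> a"
      by (rule weight_below_cong)
    have "cartan_apply n (\<lambda>i. int (a i - 1)) k = cartan_apply n (\<lambda>i. int (a i)) k" if "k \<le> n" for k
    proof -
      have "cartan_apply n (\<lambda>i. int (a i - 1)) k = cartan_apply n (\<lambda>i. int (a i) - 1) k"
      proof (rule cartan_apply_cong)
        show "int (a i - 1) = int (a i) - 1" if "i \<le> n" for i
          using Suc_pred[OF that] by linarith
      qed
      then show ?thesis
        using cartan_apply_diff[of n _ "\<lambda>_. 1"] cartan_apply_const[OF n that] by simp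
    qed
    then have "weight_below n \<Lambda> (\<lambda>i. a i - 1) \<in> wts"
      using dom by (intro dominant_in_wts) simp
    then show False
      using max weight_below_Suc_plus_null_root[of n \<Lambda> "\<lambda>i. a i - 1"] *
      by (simp add: maximal_weights_def)
  qed
next
  assume "\<exists>i\<le>n. a i = 0"
  then obtain i where i: "i \<le> n" "a i = 0" by blast
  have "(\<lambda>b. weight_below n \<Lambda> a b + null_root n b) \<notin> wts"
  proof
    assume "(\<lambda>b. weight_below n \<Lambda> a b + null_root n b) \<in> wts"
    then obtain a' where a': "(\<lambda>b. weight_below n \<Lambda> a b + null_root n b) = weight_below n \<Lambda> a'"
      using wts_weight_below[OF \<Lambda>] by blast
    have "weight_below n \<Lambda> a b = weight_below n \<Lambda> (\<lambda>i. Suc (a' i)) b" for b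
      using fun_cong[OF a', of b] fun_cong[OF weight_below_Suc_plus_null_root, of n \<Lambda> a' b]
      by (metis add_right_cancel)
    then have "a i = Suc (a' i)"
      using weight_below_inject[of n \<Lambda> a "\<lambda>i. Suc (a' i)" "\<lambda>k. int (c k)"] n c_int i(1) by blast
    then show False using i by simp
  qed
  then show "weight_below n \<Lambda> a \<in> maximal_weights n h scaleV act"
    using dominant_in_wts[OF dom] by (simp add: maximal_weights_def)
qed

lemma dominant_integral_weight_below_iff:
  "dominant_integral n (weight_below n \<Lambda> a)
    \<longleftrightarrow> (\<forall>k\<le>n. int (c k) \<ge> cartan_apply n (\<lambda>i. int (a i)) k)"
proof -
  have "weight_below n \<Lambda> a (Coroot k) \<in> \<nat> \<longleftrightarrow> int (c k) \<ge> cartan_apply n (\<lambda>i. int (a i)) k"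
    if "k \<le> n" for k
    unfolding coroot_weight_below[OF that] of_int_in_Nats_iff by simp
  then show ?thesis
    unfolding dominant_integral_def using weight_below_in_cartan_dual[OF \<Lambda>] by simp
qed

lemma dominant_maximal_weights_eq:
  "dominant_maximal_weights n h scaleV act = weight_below n \<Lambda> `
    {a. (\<forall>k\<le>n. int (c k) \<ge> cartan_apply n (\<lambda>i. int (a i)) k) \<and> (\<exists>i\<le>n. a i = 0)}" (is "?D = ?R")
proof
  show "?R \<subseteq> ?D"
    using maximal_iff dominant_integral_weight_below_iff
    by (auto simp: dominant_maximal_weights_def)
  show "?D \<subseteq> ?R"
  proof
    fix \<mu> assume "\<mu> \<in> ?D"
    then have \<mu>: "\<mu> \<in> wts" "\<mu> \<in> maximal_weights n h scaleV act" "dominant_integral n \<mu>"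
      by (auto simp: dominant_maximal_weights_def maximal_weights_def)
    then obtain a where a: "\<mu> = weight_below n \<Lambda> a"
      using wts_weight_below[OF \<Lambda>] by blast
    then have dom: "\<forall>k\<le>n. int (c k) \<ge> cartan_apply n (\<lambda>i. int (a i)) k"
      using \<mu>(3) dominant_integral_weight_below_iff by blast
    then have "\<exists>i\<le>n. a i = 0"
      using \<mu>(2) maximal_iff unfolding a by blast
    then show "\<mu> \<in> ?R" using a dom by blast
  qed
qed

lemma labels_weight_below:
  "k \<le> n \<Longrightarrow> labels n (weight_below n \<Lambda> a) k = nat (int (c k) - cartan_apply n (\<lambda>i. int (a i)) k)"
  by (simp add: labels_def coroot_weight_below flip: of_int_diff)

text \<open>Sum and moment class of the labels are the only invariants of the cosets of the root
  lattice at this level. Solvability of the Cartan equations gives surjectivity, and the zero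
  coefficient picks one solution modulo \<delta>.\<close>

lemma bij_betw_labels:
  "bij_betw (labels n) (dominant_maximal_weights n h scaleV act)
    {m \<in> compositions (n + 1) (\<Sum>k\<le>n. c k).
      [int (moment (n + 1) m) = int (\<Sum>k\<le>n. k * c k)] (mod int (n + 1))}" (is "bij_betw _ ?D ?M")
  unfolding bij_betw_def
proof
  let ?A = "{a. (\<forall>k\<le>n. int (c k) \<ge> cartan_apply n (\<lambda>i. int (a i)) k) \<and> (\<exists>i\<le>n. a i = 0)}"
  have lessThan: "{..<n + 1} = {..n}" by auto
  show "inj_on (labels n) ?D"
    unfolding dominant_maximal_weights_eq
  proof (rule inj_onI, elim imageE, hypsubst)
    fix a a' assume a: "a \<in> ?A" and a': "a' \<in> ?A"
      and eq: "labels n (weight_below n \<Lambda> a) = labels n (weight_below n \<Lambda> a')"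
    have "cartan_apply n (\<lambda>i. int (a i)) k = cartan_apply n (\<lambda>i. int (a' i)) k" if "k \<le> n" for k
    proof -
      have "int (c k) \<ge> cartan_apply n (\<lambda>i. int (a i)) k" "int (c k) \<ge> cartan_apply n (\<lambda>i. int (a' i)) k"
        using a a' that by auto
      then show ?thesis
        using fun_cong[OF eq, of k] labels_weight_below[OF that] by (simp add: eq_nat_nat_iff)
    qed
    then obtain t where t: "\<forall>k\<le>n. int (a k) = int (a' k) + t"
      using cartan_apply_eq_imp_diff_const[OF n, of "\<lambda>i. int (a i)" "\<lambda>i. int (a' i)"] by blast
    obtain i i' where "i \<le> n" "a i = 0" "i' \<le> n" "a' i' = 0" using a a' by auto
    \<comment> \<open>The zero of \<open>a\<close> forces \<open>t \<le> 0\<close> and the zero of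
      \<open>a'\<close> forces \<open>t \<ge> 0\<close>.\<close>
    then have "t = 0" using spec[OF t, of i] spec[OF t, of i'] by linarith
    then show "weight_below n \<Lambda> a = weight_below n \<Lambda> a'"
      using t by (intro weight_below_cong) auto
  qed
  show "labels n ` ?D = ?M"
  proof
    show "labels n ` ?D \<subseteq> ?M"
      unfolding dominant_maximal_weights_eq
    proof (intro subsetI, elim imageE, hypsubst)
      fix a assume a: "a \<in> ?A"
      let ?m = "labels n (weight_below n \<Lambda> a)" and ?D = "cartan_apply n (\<lambda>i. int (a i))"
      have m: "int (?m k) = int (c k) - ?D k" if "k \<le> n" for k
        using a that labels_weight_below[OF that] by simp
      have "int (\<Sum>k\<le>n. ?m k) = (\<Sum>k\<le>n. int (c k) - ?D k)"
        using m by simp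
      also have "\<dots> = int (\<Sum>k\<le>n. c k)"
        by (simp add: sum_subtractf sum_cartan_apply[OF n])
      finally have "(\<Sum>k\<le>n. ?m k) = (\<Sum>k\<le>n. c k)"
        by (simp only: of_nat_eq_iff)
      moreover have "\<forall>k\<ge>n + 1. ?m k = 0" by (simp add: labels_def)
      moreover have "int (moment (n + 1) ?m) = (\<Sum>k\<le>n. int k * (int (c k) - ?D k))"
        unfolding moment_def lessThan using m by simp
      then have "int (moment (n + 1) ?m) = int (\<Sum>k\<le>n. k * c k) - int (n + 1) * (int (a n) - int (a 0))"
        unfolding right_diff_distrib sum_subtractf sum_mult_cartan_apply[OF n] by simp
      then have "[int (moment (n + 1) ?m) = int (\<Sum>k\<le>n. k * c k)] (mod int (n + 1))"
        by (simp add: cong_iff_dvd_diff del: of_nat_add of_nat_Suc of_nat_sum)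
      ultimately show "?m \<in> ?M"
        unfolding compositions_def lessThan by blast
    qed
    show "?M \<subseteq> labels n ` ?D"
    proof
      fix m assume "m \<in> ?M"
      then have m: "\<forall>k\<ge>n + 1. m k = 0" "(\<Sum>k\<le>n. m k) = (\<Sum>k\<le>n. c k)"
        "[int (\<Sum>k\<le>n. k * m k) = int (\<Sum>k\<le>n. k * c k)] (mod int (n + 1))"
        by (auto simp: compositions_def moment_def lessThan_Suc_atMost simp del: of_nat_sum)
      have "(\<Sum>k\<le>n. int (c k) - int (m k)) = 0"
        using m(2) by (simp add: sum_subtractf flip: of_nat_sum)
      moreover have "int (n + 1) dvd (\<Sum>k\<le>n. int k * (int (c k) - int (m k)))"
        using cong_sym[OF m(3)] by (simp add: cong_iff_dvd_diff sum_subtractf right_diff_distrib)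
      ultimately obtain x where x: "\<forall>k\<le>n. cartan_apply n x k = int (c k) - int (m k)"
        using cartan_apply_surj[OF n, of "\<lambda>k. int (c k) - int (m k)"] by blast
      \<comment> \<open>Subtracting the minimum is a shift by a multiple of \<delta>: it keeps the
        labels, makes all coefficients nonnegative and one of them 0.\<close>
      define M where "M = Min (x ` {..n})"
      have "M \<in> x ` {..n}" unfolding M_def by (intro Min_in) auto
      then obtain i where i: "i \<le> n" "x i = M" by auto
      define a where "a k = nat (x k - M)" for k
      have a: "int (a k) = x k - M" if "k \<le> n" for k
        using that by (simp add: a_def M_def)
      have Da: "cartan_apply n (\<lambda>i. int (a i)) k = int (c k) - int (m k)" if k: "k \<le> n" for k
      proof -
        have "cartan_apply n (\<lambda>i. int (a i)) k = cartan_apply n (\<lambda>i. x i - M) k"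
          using a by (rule cartan_apply_cong)
        then show ?thesis
          using x k cartan_apply_diff[of n x "\<lambda>_. M"] cartan_apply_const[OF n k] by simp
      qed
      have "a \<in> ?A" using Da i by (auto simp: a_def)
      moreover have "labels n (weight_below n \<Lambda> a) = m"
      proof
        fix k show "labels n (weight_below n \<Lambda> a) k = m k"
          using m(1) Da[of k] labels_weight_below[of k a] by (cases "k \<le> n") (auto simp: labels_def)
      qed
      ultimately show "m \<in> labels n ` ?D"
        unfolding dominant_maximal_weights_eq by blast
    qed
  qed
qed

end

end

section \<open>The cardinalities and their comparison\<close>

lemma card_dominant_maximal_weights:
  assumes n: "n \<ge> 1" and l: "l \<ge> 1" and i: "i \<le> n"
    and "irreducible_highest_weight_module n scaleG bracket e f h scaleV act
           (\<lambda>b. of_nat (l - 1) * fundamental_weight 0 b + fundamental_weight i b)"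
  shows "card (dominant_maximal_weights n h scaleV act) = residue_count (n + 1) l (int i)"
proof -
  let ?\<Lambda> = "\<lambda>b. of_nat (l - 1) * fundamental_weight 0 b + fundamental_weight i b"
  interpret irreducible_highest_weight_module n scaleG bracket e f h scaleV act ?\<Lambda>
    by fact
  \<comment> \<open>Two added indicators cover \<open>i = 0\<close> as well, where the label at 0 is
    \<open>l\<close>.\<close>
  define c where "c k = (if k = 0 then l - 1 else 0) + (if k = i then 1 else 0)" for k
  have sum_c: "(\<Sum>k\<le>n. c k) = l"
    using l i by (simp add: c_def sum.distrib)
  have "(\<Sum>k\<le>n. k * c k) = (\<Sum>k\<le>n. if k = i then k else 0)"
    by (intro sum.cong) (auto simp: c_def)
  then have moment_c: "(\<Sum>k\<le>n. k * c k) = i" using i by simp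
  have "?\<Lambda> b = 0" if "b \<notin> cartan_basis n" for b
    using that i by (cases b) (auto simp: cartan_basis_def)
  then have dual: "?\<Lambda> \<in> cartan_dual n"
    by (simp add: cartan_dual_def)
  have "card (dominant_maximal_weights n h scaleV act)
      = card {m \<in> compositions (n + 1) (\<Sum>k\<le>n. c k).
        [int (moment (n + 1) m) = int (\<Sum>k\<le>n. k * c k)] (mod int (n + 1))}"
    by (rule bij_betw_same_card[OF bij_betw_labels[OF n dual]])
      (use l sum_c in \<open>auto simp: c_def\<close>)
  then show ?thesis
    unfolding sum_c moment_c residue_count_def .
qed

theorem mainTheorem11:
  fixes n l i j :: nat
    and scaleG :: "complex \<Rightarrow> 'g::ab_group_add \<Rightarrow> 'g" and bracketG :: "'g \<Rightarrow> 'g \<Rightarrow> 'g"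
    and eG fG :: "nat \<Rightarrow> 'g" and hG :: "cartan_index \<Rightarrow> 'g"
    and scaleV :: "complex \<Rightarrow> 'v::ab_group_add \<Rightarrow> 'v" and actV :: "'g \<Rightarrow> 'v \<Rightarrow> 'v"
    and scaleK :: "complex \<Rightarrow> 'k::ab_group_add \<Rightarrow> 'k" and bracketK :: "'k \<Rightarrow> 'k \<Rightarrow> 'k"
    and eK fK :: "nat \<Rightarrow> 'k" and hK :: "cartan_index \<Rightarrow> 'k"
    and scaleW :: "complex \<Rightarrow> 'w::ab_group_add \<Rightarrow> 'w" and actW :: "'k \<Rightarrow> 'w \<Rightarrow> 'w"
  assumes "n \<ge> 1" and "l \<ge> 2" and "i \<le> n" and "j \<le> l - 1"
    and "gcd (gcd (n + 1) l) i = gcd (gcd l (n + 1)) j"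
    and "irreducible_highest_weight_module n scaleG bracketG eG fG hG scaleV actV
           (\<lambda>b. of_nat (l - 1) * fundamental_weight 0 b + fundamental_weight i b)"
    and "irreducible_highest_weight_module (l - 1) scaleK bracketK eK fK hK scaleW actW
           (\<lambda>b. of_nat n * fundamental_weight 0 b + fundamental_weight j b)"
  shows "card (dominant_maximal_weights n hG scaleV actV)
       = card (dominant_maximal_weights (l - 1) hK scaleW actW)"
proof -
  have "card (dominant_maximal_weights n hG scaleV actV) = residue_count (n + 1) l (int i)"
    using assms(1-3,6) by (intro card_dominant_maximal_weights) auto
  \<comment> \<open>Here the rank is \<open>l - 1\<close> and the level \<open>n + 1\<close>, so
    tuple length and sum trade places.\<close>
  moreover have "card (dominant_maximal_weights (l - 1) hK scaleW actW)
      = residue_count (l - 1 + 1) (n + 1) (int j)"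
    using assms(2,4,7) by (intro card_dominant_maximal_weights) auto
  moreover have "residue_count (n + 1) l (int i) = residue_count l (n + 1) (int j)"
    using assms(2,5) by (intro residue_count_eq_if_gcd_eq) auto
  ultimately show ?thesis using assms(2) by simp
qed

end
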